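(* Let $t\ge \frac{1}{2}$ be real. Every minimally $t$-tough series–parallel graph has a vertex of degree $\lceil 2t\rceil$.
   Context: All graphs are finite and undirected; parallel edges are allowed. For a graph $H$, $c(H)$ denotes its number of components. A set $S\subseteq V(G)$ is a cutset if $c(G-S)>1$. $G$ is $t$-tough if $|S|\ge t\cdot c(G-S)$ for every cutset $S$; the toughness $\tau(G)$ is the largest such $t$, with $\tau(K_n)=\infty$. $G$ is minimally $t$-tough if $\tau(G)=t$ and $\tau(G-e)<t$ for every edge $e$. A series–parallel graph $G(s,t)$ with terminals $s,t$ is either a single edge $st$, or is obtained from series–parallel graphs $G_1(s_1,t_1),\dots,G_k(s_k,t_k)$, $k\ge 2$, by a series join (identify $t_i$ with $s_{i+1}$ for $1\le i\le k-1$, set $s=s_1$, $t=t_k$) or a parallel join (identify all $s_i$ into $s$ and all $t_i$ into $t$). *)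

theory Defs
  imports Complex_Main "HOL-Library.Multiset" "HOL-Library.Extended_Real"
begin

text \<open>
  Edges form a multiset of vertex sets, so that parallel edges are edges of multiplicity greater
  than one.
\<close>

record 'v mgraph =
  verts :: "'v set"
  edges :: "'v set multiset"

definition multigraph :: "'v mgraph \<Rightarrow> bool" where
  "multigraph G \<longleftrightarrow> finite (verts G) \<and> (\<forall>e \<in># edges G. e \<subseteq> verts G \<and> card e = 2)"

definition vertex_degree :: "'v mgraph \<Rightarrow> 'v \<Rightarrow> nat" where
  "vertex_degree G v = size {#e \<in># edges G. v \<in> e#}"

definition del_verts :: "'v mgraph \<Rightarrow> 'v set \<Rightarrow> 'v mgraph" where
  "del_verts G S = \<lparr>verts = verts G - S, edges = {#e \<in># edges G. e \<inter> S = {}#}\<rparr>"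

text \<open>Deleting an edge lowers its multiplicity by one; its parallel copies remain.\<close>

definition del_edge :: "'v mgraph \<Rightarrow> 'v set \<Rightarrow> 'v mgraph" where
  "del_edge G e = \<lparr>verts = verts G, edges = edges G - {#e#}\<rparr>"

definition reachable :: "'v mgraph \<Rightarrow> ('v \<times> 'v) set" where
  "reachable G = {(u, v). {u, v} \<in># edges G}\<^sup>* \<inter> verts G \<times> verts G"

definition num_components :: "'v mgraph \<Rightarrow> nat" where
  "num_components G = card (verts G // reachable G)"

definition cutset :: "'v mgraph \<Rightarrow> 'v set \<Rightarrow> bool" where
  "cutset G S \<longleftrightarrow> S \<subseteq> verts G \<and> num_components (del_verts G S) > 1"

definition tough :: "real \<Rightarrow> 'v mgraph \<Rightarrow> bool" where
  "tough t G \<longleftrightarrow> (\<forall>S. cutset G S \<longrightarrow> real (card S) \<ge> t * real (num_components (del_verts G S)))"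

text \<open>
  Without cutsets (complete graphs, possibly with parallel edges) every real \<open>t\<close> qualifies and the
  supremum is \<open>\<infinity>\<close>; otherwise it is attained, see \<open>tough_iff_le_toughness\<close> below.
\<close>

definition toughness :: "'v mgraph \<Rightarrow> ereal" where
  "toughness G = Sup {ereal t | t. tough t G}"

definition minimally_tough :: "real \<Rightarrow> 'v mgraph \<Rightarrow> bool" where
  "minimally_tough t G \<longleftrightarrow>
     toughness G = ereal t \<and> (\<forall>e \<in># edges G. toughness (del_edge G e) < ereal t)"

definition graph_union :: "nat \<Rightarrow> (nat \<Rightarrow> 'v mgraph) \<Rightarrow> 'v mgraph" where
  "graph_union k G = \<lparr>verts = (\<Union>i<k. verts (G i)), edges = (\<Sum>i<k. edges (G i))\<rparr>"

text \<open>
  Joins are described inside the resulting graph: the constituents \<open>G 0, \<dots>, G (k - 1)\<close> are already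
  glued, that is, they overlap exactly in the identified terminals and share no edges (edge
  multiplicities add up). The two terminals of a constituent are distinct, so gluing disjoint
  copies never identifies two vertices of the same constituent, and every join arises this way up to
  isomorphism.
\<close>

inductive sp_terminals :: "'v mgraph \<Rightarrow> 'v \<Rightarrow> 'v \<Rightarrow> bool" where
  edge: "s \<noteq> t \<Longrightarrow> sp_terminals \<lparr>verts = {s, t}, edges = {#{s, t}#}\<rparr> s t"
| series:
    "\<lbrakk>k \<ge> 2;
      \<forall>i<k. sp_terminals (G i) (s i) (t i);
      \<forall>i. i + 1 < k \<longrightarrow> t i = s (i + 1);
      \<forall>i j. i < j \<longrightarrow> j < k \<longrightarrow> verts (G i) \<inter> verts (G j) = (if j = i + 1 then {t i} else {})\<rbrakk>
     \<Longrightarrow> sp_terminals (graph_union k G) (s 0) (t (k - 1))"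
| parallel:
    "\<lbrakk>k \<ge> 2;
      \<forall>i<k. sp_terminals (G i) s t;
      \<forall>i j. i < j \<longrightarrow> j < k \<longrightarrow> verts (G i) \<inter> verts (G j) = {s, t}\<rbrakk>
     \<Longrightarrow> sp_terminals (graph_union k G) s t"

definition series_parallel :: "'v mgraph \<Rightarrow> bool" where
  "series_parallel G \<longleftrightarrow> (\<exists>s t. sp_terminals G s t)"

lemma tough_iff_le_toughness: "tough t G \<longleftrightarrow> ereal t \<le> toughness G"
proof
  assume "tough t G"
  then show "ereal t \<le> toughness G"
    unfolding toughness_def by (auto intro: Sup_upper)
next
  assume le: "ereal t \<le> toughness G"
  show "tough t G"
    unfolding tough_def
  proof (intro allI impI)
    fix S assume S: "cutset G S"
    let ?c = "real (num_components (del_verts G S))"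
    have c: "?c > 0" using S by (simp add: cutset_def)
    have "toughness G \<le> ereal (real (card S) / ?c)"
      unfolding toughness_def
      using S c by (intro Sup_least) (auto simp: tough_def pos_le_divide_eq)
    with le have "ereal t \<le> ereal (real (card S) / ?c)" by (rule order_trans)
    then show "t * ?c \<le> real (card S)" using c by (simp add: pos_le_divide_eq)
  qed
qed

lemma multigraph_graph_union:
  assumes "\<forall>i<k. multigraph (G i)"
  shows "multigraph (graph_union k G)"
proof -
  have "e \<subseteq> (\<Union>i<k. verts (G i)) \<and> card e = 2" if "e \<in># (\<Sum>i<k. edges (G i))" for e
  proof -
    from that obtain i where "i < k" "e \<in># edges (G i)" by (auto simp: set_mset_sum)
    with assms show ?thesis unfolding multigraph_def by blast
  qed
  then show ?thesis using assms by (simp add: multigraph_def graph_union_def)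
qed

lemma sp_terminals_multigraph:
  "sp_terminals G s t \<Longrightarrow> multigraph G \<and> s \<in> verts G \<and> t \<in> verts G \<and> s \<noteq> t"
proof (induction rule: sp_terminals.induct)
  case (edge s t)
  then show ?case by (simp add: multigraph_def)
next
  case (series k G s t)
  have mg: "multigraph (graph_union k G)"
    using series.IH by (intro multigraph_graph_union) blast
  have k: "0 < k" "k - 1 < k" using series.hyps by auto
  have ne: "s 0 \<noteq> t (k - 1)"
  proof
    assume eq: "s 0 = t (k - 1)"
    have in0: "s 0 \<in> verts (G 0)" "t (k - 1) \<in> verts (G (k - 1))" using series.IH k by auto
    have "0 < k - 1" using series.hyps by auto
    then have "verts (G 0) \<inter> verts (G (k - 1)) = (if k - 1 = 0 + 1 then {t 0} else {})"
      using series.hyps k by blast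
    then have "s 0 = t 0" using in0 eq by (auto split: if_splits)
    then show False using series.IH k by auto
  qed
  have "s 0 \<in> verts (G 0)" "t (k - 1) \<in> verts (G (k - 1))" using series.IH k by auto
  then have "s 0 \<in> verts (graph_union k G)" "t (k - 1) \<in> verts (graph_union k G)"
    using k by (auto simp: graph_union_def)
  with mg ne show ?case by blast
next
  case (parallel k G s t)
  have "multigraph (graph_union k G)"
    using parallel.IH by (intro multigraph_graph_union) blast
  moreover have k: "0 < k" using parallel.hyps by simp
  moreover have in0: "s \<in> verts (G 0) \<and> t \<in> verts (G 0) \<and> s \<noteq> t"
    using parallel.IH k by blast
  moreover have "verts (G 0) \<subseteq> verts (graph_union k G)"
    using k by (auto simp: graph_union_def)
  ultimately show ?case by blast
qed

lemma series_parallel_multigraph: "series_parallel G \<Longrightarrow> multigraph G"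
  by (auto simp: series_parallel_def dest: sp_terminals_multigraph)

end

theory Submission
  imports Defs
begin

text \<open>
  Minimality forbids parallel edges, and a simple series-parallel graph with more than one edge has
  a non-terminal vertex of degree 2, whose neighbourhood shows \<open>t \<le> 1\<close>. This settles \<open>t > 1/2\<close>.

  For \<open>t = 1/2\<close> measure a vertex set by its excess \<open>c(X - S) - 2|S|\<close>. Toughness says that the
  excess of every nonempty set is at most \<open>0\<close>, and an edge is critical iff some set that separates
  its ends in the rest of the graph has excess at least \<open>1\<close> there. Induction along the decomposition
  shows that every piece \<open>C\<close> with connected complement \<open>R\<close> and critical edges is either heavy or light;
  a series join cannot mix the two, and every parallel join is heavy. The complement of a heavy piece
  is tight at both terminals. If the remaining graph is attached at one terminal only, this is
  impossible at the other one, so no parallel join occurs there: that terminal is a leaf.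
\<close>

subsection \<open>Counting components\<close>

text \<open>Toughness one half is the hard value because \<open>\<lceil>2 * t\<rceil>\<close> drops
  to 1 there: a leaf is required and a vertex of degree 2 no longer suffices. The obstacle is that
  the criticality of an edge is witnessed by a set spread over the whole graph, so a property of the
  piece alone cannot be carried through the induction; each type constrains a piece together with
  its complement. The thresholds come from the gluing corrections. Removing both ends of a path with
  an inner vertex gives excess 1 - 4 = -3, while a single edge gives -4. Two such paths in parallel
  give -3 - 3 + 4 = -2, and -2 reproduces itself in series, as -2 - 2 + 2 = -2. Two values of -3 in
  series only reach -4, so -2 is the trace that a parallel join leaves behind. Half-toughness of the
  whole bounds the excess in a piece by 1 for sets avoiding both terminals and by 0 for sets
  containing exactly one of them. \<open>splits\<close> and \<open>tight\<close> say that these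
  bounds are attained, the former by a set separating the terminals.\<close>

definition graph_join :: "'v mgraph \<Rightarrow> 'v mgraph \<Rightarrow> 'v mgraph" where
  "graph_join X Y = \<lparr>verts = verts X \<union> verts Y, edges = edges X + edges Y\<rparr>"

lemma graph_join_simps [simp]:
  "verts (graph_join X Y) = verts X \<union> verts Y" "edges (graph_join X Y) = edges X + edges Y"
  by (simp_all add: graph_join_def)

lemma graph_join_assoc: "graph_join (graph_join X Y) Z = graph_join X (graph_join Y Z)"
  by (simp add: graph_join_def Un_assoc add.assoc)

lemma graph_join_commute: "graph_join X Y = graph_join Y X"
  by (simp add: graph_join_def Un_commute add.commute)

lemma multigraph_join: "multigraph X \<Longrightarrow> multigraph Y \<Longrightarrow> multigraph (graph_join X Y)"
  by (auto simp: multigraph_def)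

lemma del_verts_simps [simp]:
  "verts (del_verts X S) = verts X - S" "edges (del_verts X S) = {#e \<in># edges X. e \<inter> S = {}#}"
  by (simp_all add: del_verts_def)

lemma del_verts_join: "del_verts (graph_join X Y) S = graph_join (del_verts X S) (del_verts Y S)"
  by (simp add: del_verts_def graph_join_def Un_Diff)

lemma del_verts_empty [simp]: "del_verts X {} = X"
  by (simp add: del_verts_def)

lemma del_verts_cong:
  assumes "multigraph X" "S \<inter> verts X = S' \<inter> verts X"
  shows "del_verts X S = del_verts X S'"
proof -
  have "e \<inter> S = {} \<longleftrightarrow> e \<inter> S' = {}" if "e \<in># edges X" for e
    using assms that unfolding multigraph_def by blast
  then have "{#e \<in># edges X. e \<inter> S = {}#} = {#e \<in># edges X. e \<inter> S' = {}#}"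
    by (intro filter_mset_cong) auto
  moreover have "verts X - S = verts X - S'" using assms by blast
  ultimately show ?thesis by (simp add: del_verts_def)
qed

lemma multigraph_del_verts: "multigraph X \<Longrightarrow> multigraph (del_verts X S)"
  by (auto simp: multigraph_def)

lemma reachable_refl: "v \<in> verts X \<Longrightarrow> (v, v) \<in> reachable X"
  by (simp add: reachable_def)

lemma reachable_verts: "(u, v) \<in> reachable X \<Longrightarrow> u \<in> verts X \<and> v \<in> verts X"
  by (simp add: reachable_def)

lemma reachable_sym: "(u, v) \<in> reachable X \<Longrightarrow> (v, u) \<in> reachable X"
proof -
  have "sym ({(u, v). {u, v} \<in># edges X}\<^sup>*)"
    by (intro sym_rtrancl symI) (auto simp: insert_commute)
  then show "(u, v) \<in> reachable X \<Longrightarrow> (v, u) \<in> reachable X"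
    by (auto simp: reachable_def dest: symD)
qed

lemma reachable_trans: "(u, v) \<in> reachable X \<Longrightarrow> (v, w) \<in> reachable X \<Longrightarrow> (u, w) \<in> reachable X"
  by (auto simp: reachable_def)

lemma reachable_edge:
  assumes "multigraph X" "{u, v} \<in># edges X"
  shows "(u, v) \<in> reachable X"
  using assms by (auto simp: reachable_def multigraph_def)

lemma reachable_mono:
  assumes "set_mset (edges X) \<subseteq> set_mset (edges Y)" "verts X \<subseteq> verts Y"
  shows "reachable X \<subseteq> reachable Y"
proof -
  have "{(u, v). {u, v} \<in># edges X}\<^sup>* \<subseteq> {(u, v). {u, v} \<in># edges Y}\<^sup>*"
    using assms by (intro rtrancl_mono) auto
  then show ?thesis using assms by (auto simp: reachable_def)
qed

lemma reachable_join1: "p \<in> reachable X \<Longrightarrow> p \<in> reachable (graph_join X Y)"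
  using reachable_mono[of X "graph_join X Y"] by auto

lemma reachable_join2: "p \<in> reachable Y \<Longrightarrow> p \<in> reachable (graph_join X Y)"
  using reachable_mono[of Y "graph_join X Y"] by auto

text \<open>A component is represented by the common label of its vertices, itself one of them. The
  components of a glued graph then correspond to a union of two label sets, and counting them
  becomes inclusion-exclusion.\<close>

definition component_labelling :: "'v mgraph \<Rightarrow> ('v \<Rightarrow> 'v) \<Rightarrow> bool" where
  "component_labelling X f \<longleftrightarrow>
     (\<forall>v \<in> verts X. (v, f v) \<in> reachable X) \<and> (\<forall>u v. {u, v} \<in># edges X \<longrightarrow> f u = f v)"

lemma labelling_reachable_iff:
  assumes f: "component_labelling X f" and uv: "u \<in> verts X" "v \<in> verts X"
  shows "(u, v) \<in> reachable X \<longleftrightarrow> f u = f v"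
proof
  assume "(u, v) \<in> reachable X"
  then have "(u, v) \<in> {(u, v). {u, v} \<in># edges X}\<^sup>*" by (simp add: reachable_def)
  then show "f u = f v"
    by induction (use f in \<open>auto simp: component_labelling_def\<close>)
next
  assume "f u = f v"
  then show "(u, v) \<in> reachable X"
    using f uv unfolding component_labelling_def by (metis reachable_sym reachable_trans)
qed

lemma num_components_labelling:
  assumes f: "component_labelling X f"
  shows "num_components X = card (f ` verts X)"
proof -
  have cls: "reachable X `` {u} = {v \<in> verts X. f v = f u}" if "u \<in> verts X" for u
    using labelling_reachable_iff[OF f that] reachable_verts[of u _ X] by fastforce
  have "verts X // reachable X = (\<lambda>y. {v \<in> verts X. f v = y}) ` (f ` verts X)"
    using cls by (auto simp: quotient_def)
  moreover have "inj_on (\<lambda>y. {v \<in> verts X. f v = y}) (f ` verts X)"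
    by (auto simp: inj_on_def)
  ultimately show ?thesis by (simp add: num_components_def card_image)
qed

text \<open>Representatives may be prescribed on a set \<open>W\<close> that meets each component at
  most once. Prescribing them on shared vertices controls where the label sets of two glued graphs
  overlap.\<close>

lemma labelling_exists:
  assumes X: "multigraph X" and W: "W \<subseteq> verts X"
    and dis: "\<And>u v. u \<in> W \<Longrightarrow> v \<in> W \<Longrightarrow> (u, v) \<in> reachable X \<Longrightarrow> u = v"
  obtains f where "component_labelling X f" "\<And>v. v \<in> verts X \<Longrightarrow> f (f v) = f v" "\<And>w. w \<in> W \<Longrightarrow> f w = w"
proof -
  \<comment> \<open>\<open>P v\<close> depends only on the component of \<open>v\<close>, so
    \<open>Eps\<close> picks one label for the whole component, inside \<open>W\<close> if
    possible.\<close>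
  define P where "P v y \<longleftrightarrow> (v, y) \<in> reachable X \<and> ((\<exists>w \<in> W. (v, w) \<in> reachable X) \<longrightarrow> y \<in> W)" for v y
  define f where "f v = Eps (P v)" for v
  have ex: "\<exists>y. P v y" if "v \<in> verts X" for v
    using reachable_refl[OF that] unfolding P_def by blast
  have fP: "P v (f v)" if "v \<in> verts X" for v
    unfolding f_def using someI_ex[OF ex[OF that]] .
  have Peq: "P u = P v" if uv: "(u, v) \<in> reachable X" for u v
  proof -
    have "(u, y) \<in> reachable X \<longleftrightarrow> (v, y) \<in> reachable X" for y
      using uv reachable_sym reachable_trans by metis
    then show ?thesis by (simp add: P_def fun_eq_iff)
  qed
  have feq: "f u = f v" if "(u, v) \<in> reachable X" for u v
    using Peq[OF that] by (simp add: f_def)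
  have "component_labelling X f"
    unfolding component_labelling_def using fP feq reachable_edge[OF X] unfolding P_def by blast
  moreover have "f (f v) = f v" if "v \<in> verts X" for v
    using feq[of v "f v", symmetric] fP[OF that] unfolding P_def by blast
  moreover have "f w = w" if "w \<in> W" for w
  proof -
    have w: "w \<in> verts X" using that W by auto
    have "P w (f w)" using fP[OF w] .
    then have "(w, f w) \<in> reachable X" "f w \<in> W"
      using that reachable_refl[OF w] by (auto simp: P_def)
    then show ?thesis using dis[OF that] by metis
  qed
  ultimately show thesis using that by blast
qed

text \<open>A label need only be reachable in the join, not within its own side. This freedom
  matters when a connection through \<open>X\<close> merges two labels of \<open>Y\<close>.\<close>

lemma num_components_join_labelling:
  assumes f: "\<And>v. v \<in> verts X \<Longrightarrow> (v, f v) \<in> reachable (graph_join X Y)"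
      "\<And>u v. {u, v} \<in># edges X \<Longrightarrow> f u = f v"
    and g: "\<And>v. v \<in> verts Y \<Longrightarrow> (v, g v) \<in> reachable (graph_join X Y)"
      "\<And>u v. {u, v} \<in># edges Y \<Longrightarrow> g u = g v"
    and XY: "multigraph X" "multigraph Y"
    and agree: "\<And>v. v \<in> verts X \<inter> verts Y \<Longrightarrow> f v = g v"
  shows "num_components (graph_join X Y) = card (f ` verts X \<union> g ` verts Y)"
proof -
  define h where "h v = (if v \<in> verts X then f v else g v)" for v
  have hX: "h v = f v" if "v \<in> verts X" for v using that by (simp add: h_def)
  have hY: "h v = g v" if "v \<in> verts Y" for v using that agree by (simp add: h_def)
  have "component_labelling (graph_join X Y) h"
    unfolding component_labelling_def
  proof (intro conjI ballI allI impI)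
    fix v assume "v \<in> verts (graph_join X Y)"
    then show "(v, h v) \<in> reachable (graph_join X Y)"
      using f(1) g(1) by (auto simp: h_def)
  next
    fix u v assume "{u, v} \<in># edges (graph_join X Y)"
    then consider "{u, v} \<in># edges X" | "{u, v} \<in># edges Y" by auto
    then show "h u = h v"
    proof cases
      case 1
      then have "u \<in> verts X" "v \<in> verts X" using XY by (auto simp: multigraph_def)
      then show ?thesis using 1 f(2) hX by simp
    next
      case 2
      then have "u \<in> verts Y" "v \<in> verts Y" using XY by (auto simp: multigraph_def)
      then show ?thesis using 2 g(2) hY by simp
    qed
  qed
  then have "num_components (graph_join X Y) = card (h ` (verts X \<union> verts Y))"
    by (simp add: num_components_labelling)
  also have "h ` (verts X \<union> verts Y) = f ` verts X \<union> g ` verts Y"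
    unfolding image_Un using hX hY by (simp cong: image_cong)
  finally show ?thesis .
qed

lemma labelling_join:
  assumes f: "component_labelling X f" and g: "component_labelling Y g"
    and XY: "multigraph X" "multigraph Y"
    and agree: "\<And>v. v \<in> verts X \<inter> verts Y \<Longrightarrow> f v = g v"
  shows "num_components (graph_join X Y) = card (f ` verts X \<union> g ` verts Y)"
  using f g agree unfolding component_labelling_def
  by (intro num_components_join_labelling XY) (auto intro: reachable_join1 reachable_join2)

lemma labelling_image_subset:
  "component_labelling X f \<Longrightarrow> f ` verts X \<subseteq> verts X"
  unfolding component_labelling_def using reachable_verts by fast

text \<open>Shared vertices lie in different components on each side, so each can be its own label;
  the two label sets then meet exactly in the shared vertices.\<close>

lemma num_components_join_separated:
  assumes XY: "multigraph X" "multigraph Y"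
    and disX: "\<And>u v. u \<in> verts X \<inter> verts Y \<Longrightarrow> v \<in> verts X \<inter> verts Y \<Longrightarrow> (u, v) \<in> reachable X \<Longrightarrow> u = v"
    and disY: "\<And>u v. u \<in> verts X \<inter> verts Y \<Longrightarrow> v \<in> verts X \<inter> verts Y \<Longrightarrow> (u, v) \<in> reachable Y \<Longrightarrow> u = v"
  shows "num_components (graph_join X Y) + card (verts X \<inter> verts Y) = num_components X + num_components Y"
proof -
  let ?W = "verts X \<inter> verts Y"
  obtain f where f: "component_labelling X f" "\<And>w. w \<in> ?W \<Longrightarrow> f w = w"
    by (rule labelling_exists[OF XY(1), of ?W]) (use disX in auto)
  obtain g where g: "component_labelling Y g" "\<And>w. w \<in> ?W \<Longrightarrow> g w = w"
    by (rule labelling_exists[OF XY(2), of ?W]) (use disY in auto)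
  have "w \<in> f ` verts X" "w \<in> g ` verts Y" if "w \<in> ?W" for w
    using imageI[of w "verts X" f] imageI[of w "verts Y" g] f(2)[OF that] g(2)[OF that] that by simp_all
  then have "?W \<subseteq> f ` verts X" "?W \<subseteq> g ` verts Y" by blast+
  then have "f ` verts X \<inter> g ` verts Y = ?W"
    using labelling_image_subset[OF f(1)] labelling_image_subset[OF g(1)] by blast
  moreover have "finite (f ` verts X)" "finite (g ` verts Y)" using XY by (auto simp: multigraph_def)
  ultimately have "card (f ` verts X \<union> g ` verts Y) + card ?W = card (f ` verts X) + card (g ` verts Y)"
    using card_Un_Int[of "f ` verts X" "g ` verts Y"] by simp
  moreover have "f v = g v" if "v \<in> ?W" for v using f(2) g(2) that by simp
  ultimately show ?thesis
    using labelling_join[OF f(1) g(1) XY] num_components_labelling[OF f(1)] num_components_labelling[OF g(1)]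
    by presburger
qed

text \<open>Both sides label the component of \<open>a\<close> and \<open>b\<close> by
  \<open>a\<close>, so the label sets meet only in \<open>a\<close>: the gluing at \<open>b\<close>
  closes a cycle and merges nothing further.\<close>

lemma num_components_join_connected:
  assumes XY: "multigraph X" "multigraph Y" and W: "verts X \<inter> verts Y = {a, b}"
    and ab: "(a, b) \<in> reachable X" "(a, b) \<in> reachable Y" "a \<noteq> b"
  shows "num_components (graph_join X Y) + 1 = num_components X + num_components Y"
proof -
  obtain f where f: "component_labelling X f" "\<And>v. v \<in> verts X \<Longrightarrow> f (f v) = f v" "f a = a"
    by (rule labelling_exists[OF XY(1), of "{a}"]) (use W in auto)
  obtain g where g: "component_labelling Y g" "\<And>v. v \<in> verts Y \<Longrightarrow> g (g v) = g v" "g a = a"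
    by (rule labelling_exists[OF XY(2), of "{a}"]) (use W in auto)
  have abV: "a \<in> verts X" "b \<in> verts X" "a \<in> verts Y" "b \<in> verts Y" using W by auto
  then have "f a = f b" "g a = g b"
    using labelling_reachable_iff[OF f(1), of a b] labelling_reachable_iff[OF g(1), of a b] ab by blast+
  then have fb: "f b = a" and gb: "g b = a" using f(3) g(3) by metis+
  have "b \<notin> f ` verts X"
  proof
    assume "b \<in> f ` verts X"
    then obtain v where "v \<in> verts X" "b = f v" by blast
    then show False using f(2)[of v] fb ab(3) by simp
  qed
  moreover have "a \<in> f ` verts X" "a \<in> g ` verts Y"
    using abV f(3) g(3) imageI[of a "verts X" f] imageI[of a "verts Y" g] by simp_all
  ultimately have int: "f ` verts X \<inter> g ` verts Y = {a}"
    using labelling_image_subset[OF f(1)] labelling_image_subset[OF g(1)] W by blast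
  moreover have "finite (f ` verts X)" "finite (g ` verts Y)" using XY by (auto simp: multigraph_def)
  ultimately have "card (f ` verts X \<union> g ` verts Y) + 1 = card (f ` verts X) + card (g ` verts Y)"
    using card_Un_Int[of "f ` verts X" "g ` verts Y"] by simp
  moreover have "f v = g v" if "v \<in> verts X \<inter> verts Y" for v
    using that f(3) g(3) fb gb unfolding W by auto
  ultimately show ?thesis
    using labelling_join[OF f(1) g(1) XY] num_components_labelling[OF f(1)] num_components_labelling[OF g(1)]
    by presburger
qed

text \<open>\<open>Y\<close> has separate labels for \<open>a\<close> and \<open>b\<close>. The
  connection through \<open>X\<close> merges them, which costs one component; the overlap of the
  label sets in \<open>a\<close> costs the other.\<close>

lemma num_components_join_half:
  assumes XY: "multigraph X" "multigraph Y" and W: "verts X \<inter> verts Y = {a, b}"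
    and ab: "(a, b) \<in> reachable X" "(a, b) \<notin> reachable Y" "a \<noteq> b"
  shows "num_components (graph_join X Y) + 2 = num_components X + num_components Y"
proof -
  obtain f where f: "component_labelling X f" "\<And>v. v \<in> verts X \<Longrightarrow> f (f v) = f v" "f a = a"
    by (rule labelling_exists[OF XY(1), of "{a}"]) (use W in auto)
  have ba: "(b, a) \<notin> reachable Y" using ab reachable_sym by metis
  have abY: "a \<in> verts Y" "b \<in> verts Y" "a \<in> verts X" "b \<in> verts X" using W by auto
  obtain g where g: "component_labelling Y g" "\<And>w. w \<in> {a, b} \<Longrightarrow> g w = w"
    by (rule labelling_exists[OF XY(2), of "{a, b}"]) (use abY ab ba in auto)
  have "f a = f b" using labelling_reachable_iff[OF f(1), of a b] ab(1) abY by blast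
  then have fb: "f b = a" using f(3) by metis
  define r where "r v = (if v = b then a else v)" for v
  have agree: "f w = r (g w)" if "w \<in> verts Y" "w \<in> verts X" for w
  proof -
    have "w = a \<or> w = b" using that W by blast
    then show ?thesis using f(3) fb g(2) ab(3) by (elim disjE) (simp_all add: r_def)
  qed
  have abJ: "(b, a) \<in> reachable (graph_join X Y)"
    using ab(1) reachable_join1 reachable_sym by metis
  have "num_components (graph_join X Y) = card (f ` verts X \<union> (\<lambda>v. r (g v)) ` verts Y)"
  proof (rule num_components_join_labelling[OF _ _ _ _ XY])
    fix v assume "v \<in> verts Y"
    then have "(v, g v) \<in> reachable (graph_join X Y)"
      using g(1) reachable_join2 unfolding component_labelling_def by blast
    then show "(v, r (g v)) \<in> reachable (graph_join X Y)"
      using abJ reachable_trans[of v b "graph_join X Y" a] by (cases "g v = b") (simp_all add: r_def)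
  next
    show "(v, f v) \<in> reachable (graph_join X Y)" if "v \<in> verts X" for v
      using f(1) that reachable_join1 unfolding component_labelling_def by blast
    show "f u = f v" if "{u, v} \<in># edges X" for u v
      using f(1) that unfolding component_labelling_def by blast
    show "r (g u) = r (g v)" if "{u, v} \<in># edges Y" for u v
      using g(1) that unfolding component_labelling_def by metis
    show "f v = r (g v)" if "v \<in> verts X \<inter> verts Y" for v
      using agree that by blast
  qed
  also have "(\<lambda>v. r (g v)) ` verts Y = r ` g ` verts Y" by (simp add: image_image)
  also have "r ` g ` verts Y = g ` verts Y - {b}"
  proof -
    have "a \<in> g ` verts Y" using abY g(2) imageI[of a "verts Y" g] by simp
    then show ?thesis using ab(3) by (auto simp: r_def)
  qed
  finally have im: "num_components (graph_join X Y) = card (f ` verts X \<union> (g ` verts Y - {b}))" .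
  have fin: "finite (f ` verts X)" "finite (g ` verts Y)" using XY by (auto simp: multigraph_def)
  have "a \<in> f ` verts X" "a \<in> g ` verts Y" "b \<in> g ` verts Y"
    using abY f(3) g(2) imageI[of a "verts X" f] imageI[of a "verts Y" g] imageI[of b "verts Y" g] by simp_all
  then have int: "f ` verts X \<inter> (g ` verts Y - {b}) = {a}" and b: "b \<in> g ` verts Y"
    using labelling_image_subset[OF f(1)] labelling_image_subset[OF g(1)] W ab(3) by blast+
  have "card (f ` verts X \<union> (g ` verts Y - {b})) + 1 = card (f ` verts X) + card (g ` verts Y - {b})"
    using card_Un_Int[of "f ` verts X" "g ` verts Y - {b}"] int fin by simp
  moreover have "card (g ` verts Y - {b}) + 1 = card (g ` verts Y)"
    using card_Suc_Diff1[OF fin(2) b] by simp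
  ultimately show ?thesis
    using im num_components_labelling[OF f(1)] num_components_labelling[OF g(1)]
    by simp
qed

subsection \<open>Excess of a vertex set\<close>

abbreviation linked :: "'v mgraph \<Rightarrow> 'v set \<Rightarrow> 'v \<Rightarrow> 'v \<Rightarrow> bool" where
  "linked X S u v \<equiv> (u, v) \<in> reachable (del_verts X S)"

text \<open>\<open>S\<close> may contain vertices outside \<open>X\<close>; they are not counted. Hence one set can be evaluated on
  all pieces of a decomposed graph. When two pieces are glued, the excesses add up, with a correction
  for the shared vertices: one in \<open>S\<close> is counted twice (\<open>+2\<close>), one outside \<open>S\<close> merges two components
  (\<open>-1\<close>) unless these are already merged.\<close>

definition excess :: "'v mgraph \<Rightarrow> 'v set \<Rightarrow> int" where
  "excess X S = int (num_components (del_verts X S)) - 2 * int (card (S \<inter> verts X))"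

lemma excess_cong:
  assumes "multigraph X" "S \<inter> verts X = S' \<inter> verts X"
  shows "excess X S = excess X S'"
  using del_verts_cong[OF assms] assms(2) by (simp add: excess_def)

lemma excess_disjoint:
  assumes "multigraph X" "S \<inter> verts X = {}"
  shows "excess X S = int (num_components X)"
  using excess_cong[of X S "{}"] assms by (simp add: excess_def)

lemma num_components_pos:
  assumes X: "multigraph X" and v: "v \<in> verts X"
  shows "num_components X > 0"
proof -
  obtain f where f: "component_labelling X f"
    by (rule labelling_exists[OF X, of "{}"]) auto
  have "finite (f ` verts X)" "f ` verts X \<noteq> {}" using X v by (auto simp: multigraph_def)
  then show ?thesis using num_components_labelling[OF f] by (simp add: card_gt_0_iff)
qed

lemma connected_reachable:
  assumes X: "multigraph X" "num_components X = 1" and uv: "u \<in> verts X" "v \<in> verts X"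
  shows "(u, v) \<in> reachable X"
proof -
  obtain f where f: "component_labelling X f"
    by (rule labelling_exists[OF X(1), of "{}"]) auto
  then have "card (f ` verts X) = 1" using X(2) num_components_labelling[of X f] by simp
  then obtain c where "f ` verts X = {c}" by (rule card_1_singletonE)
  then have "f u = f v" using imageI[OF uv(1), of f] imageI[OF uv(2), of f] by simp
  then show ?thesis using labelling_reachable_iff[OF f uv] by simp
qed

lemma card_inter_join:
  assumes "multigraph X" "multigraph Y"
  shows "card (S \<inter> verts (graph_join X Y)) + card (S \<inter> (verts X \<inter> verts Y))
    = card (S \<inter> verts X) + card (S \<inter> verts Y)"
proof -
  have "finite (S \<inter> verts X)" "finite (S \<inter> verts Y)" using assms by (auto simp: multigraph_def)
  then have "card (S \<inter> verts X) + card (S \<inter> verts Y)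
      = card (S \<inter> verts X \<union> S \<inter> verts Y) + card (S \<inter> verts X \<inter> (S \<inter> verts Y))"
    by (rule card_Un_Int)
  moreover have "S \<inter> verts X \<inter> (S \<inter> verts Y) = S \<inter> (verts X \<inter> verts Y)" by blast
  ultimately show ?thesis by (simp add: Int_Un_distrib)
qed

lemma excess_join_separated:
  assumes XY: "multigraph X" "multigraph Y"
    and "\<And>u v. u \<in> verts X \<inter> verts Y - S \<Longrightarrow> v \<in> verts X \<inter> verts Y - S \<Longrightarrow> linked X S u v \<Longrightarrow> u = v"
    and "\<And>u v. u \<in> verts X \<inter> verts Y - S \<Longrightarrow> v \<in> verts X \<inter> verts Y - S \<Longrightarrow> linked Y S u v \<Longrightarrow> u = v"
  shows "excess (graph_join X Y) S = excess X S + excess Y S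
    + 2 * int (card (S \<inter> (verts X \<inter> verts Y))) - int (card (verts X \<inter> verts Y - S))"
proof -
  have W: "verts (del_verts X S) \<inter> verts (del_verts Y S) = verts X \<inter> verts Y - S" by auto
  have "num_components (graph_join (del_verts X S) (del_verts Y S)) + card (verts X \<inter> verts Y - S)
      = num_components (del_verts X S) + num_components (del_verts Y S)"
    using num_components_join_separated[of "del_verts X S" "del_verts Y S", unfolded W]
      multigraph_del_verts[OF XY(1)] multigraph_del_verts[OF XY(2)] assms(3,4) by blast
  then show ?thesis
    using card_inter_join[OF XY, of S] by (simp add: excess_def del_verts_join)
qed

lemma excess_join_cut:
  assumes XY: "multigraph X" "multigraph Y" and W: "verts X \<inter> verts Y = {x}"
  shows "x \<in> S \<Longrightarrow> excess (graph_join X Y) S = excess X S + excess Y S + 2"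
    and "x \<notin> S \<Longrightarrow> excess (graph_join X Y) S = excess X S + excess Y S - 1"
  using excess_join_separated[OF XY, of S] unfolding W by (auto simp: insert_Diff_if)

text \<open>Outside \<open>S\<close>, the gluing at the second shared vertex merges two components
  again, unless the first gluing has already joined them; this happens exactly when both pieces link
  \<open>a\<close> and \<open>b\<close>.\<close>

lemma excess_join_pair:
  assumes XY: "multigraph X" "multigraph Y" and W: "verts X \<inter> verts Y = {a, b}" and ab: "a \<noteq> b"
  shows "a \<in> S \<Longrightarrow> b \<in> S \<Longrightarrow> excess (graph_join X Y) S = excess X S + excess Y S + 4"
    and "a \<in> S \<Longrightarrow> b \<notin> S \<Longrightarrow> excess (graph_join X Y) S = excess X S + excess Y S + 1"
    and "a \<notin> S \<Longrightarrow> b \<notin> S \<Longrightarrow> \<not> (linked X S a b \<and> linked Y S a b) \<Longrightarrow>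
      excess (graph_join X Y) S = excess X S + excess Y S - 2"
    and "a \<notin> S \<Longrightarrow> b \<notin> S \<Longrightarrow> linked X S a b \<Longrightarrow> linked Y S a b \<Longrightarrow>
      excess (graph_join X Y) S = excess X S + excess Y S - 1"
proof -
  note sep = excess_join_separated[OF XY, of S, unfolded W]
  show "excess (graph_join X Y) S = excess X S + excess Y S + 4" if "a \<in> S" "b \<in> S"
  proof -
    have "{a, b} - S = {}" "S \<inter> {a, b} = {a, b}" using that by auto
    then show ?thesis using sep ab by simp
  qed
  show "excess (graph_join X Y) S = excess X S + excess Y S + 1" if "a \<in> S" "b \<notin> S"
  proof -
    have "{a, b} - S = {b}" "S \<inter> {a, b} = {a}" using that by auto
    then show ?thesis using sep by simp
  qed
  assume n: "a \<notin> S" "b \<notin> S"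
  let ?X = "del_verts X S" and ?Y = "del_verts Y S"
  have W': "verts ?X \<inter> verts ?Y = {a, b}" "verts ?Y \<inter> verts ?X = {a, b}" using W n by auto
  have m: "multigraph ?X" "multigraph ?Y" using XY by (auto intro: multigraph_del_verts)
  have sizes: "card (S \<inter> (verts X \<union> verts Y)) = card (S \<inter> verts X) + card (S \<inter> verts Y)"
    using card_inter_join[OF XY, of S, unfolded W] n by simp
  show "excess (graph_join X Y) S = excess X S + excess Y S - 2"
    if nl: "\<not> (linked X S a b \<and> linked Y S a b)"
  proof -
    consider "\<not> linked X S a b" "\<not> linked Y S a b" | "linked X S a b" "\<not> linked Y S a b"
      | "\<not> linked X S a b" "linked Y S a b" using nl by blast
    then have "num_components (graph_join ?X ?Y) + 2 = num_components ?X + num_components ?Y"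
    proof cases
      case 1
      moreover have "\<not> linked X S b a" "\<not> linked Y S b a"
        using 1 reachable_sym[of b a "del_verts X S"] reachable_sym[of b a "del_verts Y S"] by auto
      ultimately have "num_components (graph_join ?X ?Y) + card {a, b} = num_components ?X + num_components ?Y"
        by (intro num_components_join_separated[OF m, unfolded W'(1)]) auto
      then show ?thesis using ab by simp
    next
      case 2
      then show ?thesis by (intro num_components_join_half[OF m W'(1) _ _ ab])
    next
      case 3
      then show ?thesis
        using num_components_join_half[OF m(2,1) W'(2) 3(2,1) ab] graph_join_commute[of ?X ?Y] by simp
    qed
    then show ?thesis using sizes by (simp add: excess_def del_verts_join)
  qed
  show "excess (graph_join X Y) S = excess X S + excess Y S - 1"
    if "linked X S a b" "linked Y S a b"
    using num_components_join_connected[OF m W'(1) that ab] sizes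
    by (simp add: excess_def del_verts_join)
qed

subsection \<open>Binary joins\<close>

text \<open>A join of \<open>k\<close> constituents is built up by adding one constituent at a time,
  so that later inductions have only two join cases.\<close>

inductive binary_sp :: "'v mgraph \<Rightarrow> 'v \<Rightarrow> 'v \<Rightarrow> bool" where
  edge: "s \<noteq> t \<Longrightarrow> binary_sp \<lparr>verts = {s, t}, edges = {#{s, t}#}\<rparr> s t"
| series: "binary_sp A s x \<Longrightarrow> binary_sp B x t \<Longrightarrow> verts A \<inter> verts B = {x} \<Longrightarrow> binary_sp (graph_join A B) s t"
| parallel: "binary_sp A s t \<Longrightarrow> binary_sp B s t \<Longrightarrow> verts A \<inter> verts B = {s, t} \<Longrightarrow> binary_sp (graph_join A B) s t"

lemma graph_union_1: "graph_union (Suc 0) G = G 0"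
  by (intro mgraph.equality) (simp_all add: graph_union_def lessThan_Suc)

lemma graph_union_Suc: "graph_union (Suc j) G = graph_join (graph_union j G) (G j)"
  by (simp add: graph_union_def graph_join_def lessThan_Suc Un_commute add.commute)

lemma sp_terminals_binary: "sp_terminals G s t \<Longrightarrow> binary_sp G s t"
proof (induction rule: sp_terminals.induct)
  case (edge s t)
  then show ?case by (rule binary_sp.edge)
next
  case (series k G s t)
  \<comment> \<open>Induction over prefixes of the join: \<open>G (Suc j)\<close> meets the union of
    its predecessors only in \<open>t j\<close>.\<close>
  have "Suc j \<le> k \<Longrightarrow> binary_sp (graph_union (Suc j) G) (s 0) (t j)" for j
  proof (induction j)
    case 0
    then show ?case using series.IH by (simp add: graph_union_1)
  next
    case (Suc j)
    have jk: "j < k" "Suc j < k" using Suc.prems by auto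
    have tj_s: "t j = s (Suc j)" using series.hyps(2) jk(2) by simp
    have ends: "binary_sp (G (Suc j)) (t j) (t (Suc j))" unfolding tj_s using series.IH jk(2) by blast
    have pieces: "sp_terminals (G j) (s j) (t j)" "sp_terminals (G (Suc j)) (s (Suc j)) (t (Suc j))"
      using series.IH jk by blast+
    have tj: "t j \<in> verts (G j)" "t j \<in> verts (G (Suc j))"
      using sp_terminals_multigraph[OF pieces(1)] sp_terminals_multigraph[OF pieces(2)]
      unfolding tj_s by simp_all
    have "verts (graph_union (Suc j) G) \<inter> verts (G (Suc j)) = {t j}"
    proof
      show "verts (graph_union (Suc j) G) \<inter> verts (G (Suc j)) \<subseteq> {t j}"
      proof
        fix v assume v: "v \<in> verts (graph_union (Suc j) G) \<inter> verts (G (Suc j))"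
        then obtain i where i: "i < Suc j" "v \<in> verts (G i)" by (auto simp: graph_union_def)
        then have "verts (G i) \<inter> verts (G (Suc j)) = (if Suc j = i + 1 then {t i} else {})"
          using series.hyps(3) jk(2) by blast
        then show "v \<in> {t j}" using v i by (auto split: if_splits)
      qed
      show "{t j} \<subseteq> verts (graph_union (Suc j) G) \<inter> verts (G (Suc j))"
        using tj by (auto simp: graph_union_def)
    qed
    then show ?case
      using binary_sp.series[OF Suc.IH ends] Suc.prems by (simp add: graph_union_Suc[of "Suc j" G])
  qed
  from this[of "k - 1"] show ?case using series.hyps by simp
next
  case (parallel k G s t)
  have st: "s \<in> verts (G i)" "t \<in> verts (G i)" if "i < k" for i
    using parallel.IH that sp_terminals_multigraph[of "G i" s t] by blast+
  have "Suc j \<le> k \<Longrightarrow> binary_sp (graph_union (Suc j) G) s t" for j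
  proof (induction j)
    case 0
    then show ?case using parallel.IH by (simp add: graph_union_1)
  next
    case (Suc j)
    have jk: "Suc j < k" using Suc.prems by auto
    have "binary_sp (G (Suc j)) s t" using parallel.IH jk by blast
    moreover have "verts (graph_union (Suc j) G) \<inter> verts (G (Suc j)) = {s, t}"
    proof
      show "verts (graph_union (Suc j) G) \<inter> verts (G (Suc j)) \<subseteq> {s, t}"
      proof
        fix v assume v: "v \<in> verts (graph_union (Suc j) G) \<inter> verts (G (Suc j))"
        then obtain i where i: "i < Suc j" "v \<in> verts (G i)" by (auto simp: graph_union_def)
        then have "verts (G i) \<inter> verts (G (Suc j)) = {s, t}"
          using parallel.hyps(2) jk by blast
        then show "v \<in> {s, t}" using v i by auto
      qed
      show "{s, t} \<subseteq> verts (graph_union (Suc j) G) \<inter> verts (G (Suc j))"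
        using st[of 0] st[of "Suc j"] jk by (auto simp: graph_union_def)
    qed
    ultimately show ?case
      using binary_sp.parallel[OF Suc.IH] Suc.prems by (simp add: graph_union_Suc[of "Suc j" G])
  qed
  from this[of "k - 1"] show ?case using parallel.hyps by simp
qed

lemma num_components_join_cut:
  assumes "multigraph X" "multigraph Y" "verts X \<inter> verts Y = {x}"
    "num_components X = 1" "num_components Y = 1"
  shows "num_components (graph_join X Y) = 1"
  using num_components_join_separated[OF assms(1,2)] assms(3-5) by auto

lemma num_components_join_pair:
  assumes "multigraph X" "multigraph Y" "verts X \<inter> verts Y = {a, b}" "a \<noteq> b"
    "num_components X = 1" "num_components Y = 1"
  shows "num_components (graph_join X Y) = 1"
  using num_components_join_connected[OF assms(1-3)] assms(3-6)
    connected_reachable[of X a b] connected_reachable[of Y a b] assms(1,2) by auto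

lemma num_components_edge:
  assumes "s \<noteq> t"
  shows "num_components \<lparr>verts = {s, t}, edges = {#{s, t}#}\<rparr> = 1"
proof -
  let ?E = "\<lparr>verts = {s, t}, edges = {#{s, t}#}\<rparr>"
  have m: "multigraph ?E" using assms by (simp add: multigraph_def)
  have "component_labelling ?E (\<lambda>_. s)"
    using reachable_edge[OF m, of t s] reachable_refl[of s ?E]
    by (auto simp: component_labelling_def insert_commute)
  then show ?thesis using num_components_labelling by fastforce
qed

lemma binary_sp_basic:
  "binary_sp G s t \<Longrightarrow> multigraph G \<and> s \<in> verts G \<and> t \<in> verts G \<and> s \<noteq> t \<and> num_components G = 1"
proof (induction rule: binary_sp.induct)
  case (edge s t)
  then show ?case using num_components_edge by (simp add: multigraph_def)
next
  case (series A s x B t)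
  then have "s \<noteq> t" by auto
  then show ?case
    using series.IH num_components_join_cut[OF _ _ series.hyps(3)] by (auto intro: multigraph_join)
next
  case (parallel A s t B)
  then show ?case using num_components_join_pair multigraph_join by auto
qed

subsection \<open>Pieces and their complements\<close>

text \<open>Non-cutsets are covered too: a set that meets \<open>H\<close> and leaves at most one
  component has negative excess. Sets missing \<open>H\<close> are excluded, since a connected
  multigraph gives them excess 1.\<close>

definition half_tough :: "'v mgraph \<Rightarrow> bool" where
  "half_tough H \<longleftrightarrow> (\<forall>S. S \<inter> verts H \<noteq> {} \<longrightarrow> excess H S \<le> 0)"

lemma half_toughD: "half_tough H \<Longrightarrow> v \<in> S \<Longrightarrow> v \<in> verts H \<Longrightarrow> excess H S \<le> 0"
  unfolding half_tough_def by blast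

definition attached :: "'v mgraph \<Rightarrow> 'v mgraph \<Rightarrow> 'v \<Rightarrow> 'v \<Rightarrow> bool" where
  "attached X Y a b \<longleftrightarrow> multigraph X \<and> multigraph Y \<and> verts X \<inter> verts Y = {a, b} \<and> a \<noteq> b \<and>
     num_components X = 1 \<and> num_components Y = 1 \<and> half_tough (graph_join X Y)"

lemma attachedD:
  assumes "attached X Y a b"
  shows "multigraph X" "multigraph Y" "verts X \<inter> verts Y = {a, b}" "a \<noteq> b"
    "num_components X = 1" "num_components Y = 1" "half_tough (graph_join X Y)"
    "a \<in> verts X" "b \<in> verts X" "a \<in> verts Y" "b \<in> verts Y"
  using assms unfolding attached_def by auto

lemma attached_common: "attached X Y a b \<Longrightarrow> v \<in> verts X \<Longrightarrow> v \<in> verts Y \<Longrightarrow> v = a \<or> v = b"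
  unfolding attached_def by blast

lemma attached_commute: "attached X Y a b \<Longrightarrow> attached Y X a b"
  by (auto simp: attached_def Int_commute graph_join_commute)

lemma attached_swap: "attached X Y a b \<Longrightarrow> attached X Y b a"
  by (auto simp: attached_def insert_commute)

lemma excess_attached:
  assumes "attached X Y a b"
  shows "a \<in> S \<Longrightarrow> b \<in> S \<Longrightarrow> excess (graph_join X Y) S = excess X S + excess Y S + 4"
    and "a \<in> S \<Longrightarrow> b \<notin> S \<Longrightarrow> excess (graph_join X Y) S = excess X S + excess Y S + 1"
    and "a \<notin> S \<Longrightarrow> b \<notin> S \<Longrightarrow> \<not> (linked X S a b \<and> linked Y S a b) \<Longrightarrow>
      excess (graph_join X Y) S = excess X S + excess Y S - 2"
    and "a \<notin> S \<Longrightarrow> b \<notin> S \<Longrightarrow> linked X S a b \<Longrightarrow> linked Y S a b \<Longrightarrow>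
      excess (graph_join X Y) S = excess X S + excess Y S - 1"
  by (fact excess_join_pair[OF attachedD(1-4)[OF assms]])+

text \<open>If \<open>S\<close> meets \<open>X\<close>, its restriction to \<open>X\<close> leaves
  \<open>Y\<close> whole with excess 1, and the correction is at least -2; hence
  \<open>excess X S + 1 - 2 \<le> 0\<close>.\<close>

lemma excess_le_1:
  assumes XY: "attached X Y a b" and S: "a \<notin> S" "b \<notin> S"
  shows "excess X S \<le> 1"
proof (cases "S \<inter> verts X = {}")
  case True
  then show ?thesis using excess_disjoint attachedD(1,5)[OF XY] by fastforce
next
  case False
  let ?T = "S \<inter> verts X"
  have T: "a \<notin> ?T" "b \<notin> ?T" using S by auto
  have "?T \<inter> verts Y = {}" unfolding Int_assoc attachedD(3)[OF XY] using S by simp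
  then have "excess Y ?T = 1" using excess_disjoint attachedD(2,6)[OF XY] by fastforce
  moreover obtain v where "v \<in> ?T" using False by blast
  then have "excess (graph_join X Y) ?T \<le> 0"
    by (intro half_toughD[OF attachedD(7)[OF XY], where v = v]) simp_all
  moreover have "excess (graph_join X Y) ?T \<ge> excess X ?T + excess Y ?T - 2"
    using excess_attached(3,4)[OF XY T] by force
  moreover have "excess X ?T = excess X S" by (rule excess_cong[OF attachedD(1)[OF XY]]) blast
  ultimately show ?thesis by linarith
qed

text \<open>Restricted to \<open>X\<close>, the set takes only \<open>a\<close> from
  \<open>Y\<close>, where \<open>b\<close> survives. So \<open>Y\<close> contributes at least 1 - 2,
  which the correction +1 cancels.\<close>

lemma excess_le_0:
  assumes XY: "attached X Y a b" and S: "a \<in> S" "b \<notin> S"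
  shows "excess X S \<le> 0"
proof -
  let ?T = "S \<inter> verts X"
  have T: "a \<in> ?T" "b \<notin> ?T" using S attachedD[OF XY] by auto
  have "?T \<inter> verts Y = {a}" unfolding Int_assoc attachedD(3)[OF XY] using S by auto
  moreover have "b \<in> verts (del_verts Y ?T)" using attachedD(11)[OF XY] T by auto
  then have "num_components (del_verts Y ?T) > 0"
    using num_components_pos multigraph_del_verts attachedD(2)[OF XY] by metis
  ultimately have "excess Y ?T \<ge> -1" by (simp add: excess_def)
  moreover have "excess (graph_join X Y) ?T \<le> 0"
    using half_toughD[OF attachedD(7)[OF XY] T(1)] attachedD(8)[OF XY] by simp
  moreover have "excess (graph_join X Y) ?T = excess X ?T + excess Y ?T + 1"
    by (rule excess_attached(2)[OF XY T])
  moreover have "excess X ?T = excess X S" by (rule excess_cong[OF attachedD(1)[OF XY]]) blast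
  ultimately show ?thesis by linarith
qed

text \<open>The types of a piece \<open>C\<close> and of its complement \<open>R\<close>. A piece is heavy if it satisfies
  \<open>full C a b (-2)\<close> and \<open>R\<close> is tight at both terminals; a path is the typical \<open>light\<close> piece.
  \<open>splits R a b\<close> is what the criticality of a single edge \<open>ab\<close> says about its complement.\<close>

definition slack :: "'v mgraph \<Rightarrow> 'v \<Rightarrow> 'v \<Rightarrow> bool" where
  "slack C a b \<longleftrightarrow> (\<forall>S. a \<in> S \<longrightarrow> b \<notin> S \<longrightarrow> excess C S \<le> -1)"

definition tight :: "'v mgraph \<Rightarrow> 'v \<Rightarrow> 'v \<Rightarrow> bool" where
  "tight R a b \<longleftrightarrow> (\<exists>S \<subseteq> verts R. a \<in> S \<and> b \<notin> S \<and> excess R S \<ge> 0)"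

definition splits :: "'v mgraph \<Rightarrow> 'v \<Rightarrow> 'v \<Rightarrow> bool" where
  "splits R a b \<longleftrightarrow> (\<exists>S \<subseteq> verts R. a \<notin> S \<and> b \<notin> S \<and> \<not> linked R S a b \<and> excess R S \<ge> 1)"

definition full :: "'v mgraph \<Rightarrow> 'v \<Rightarrow> 'v \<Rightarrow> int \<Rightarrow> bool" where
  "full C a b n \<longleftrightarrow> (\<exists>S \<subseteq> verts C. a \<in> S \<and> b \<in> S \<and> excess C S \<ge> n)"

definition light :: "'v mgraph \<Rightarrow> 'v \<Rightarrow> 'v \<Rightarrow> bool" where
  "light C a b \<longleftrightarrow> (\<forall>S. a \<in> S \<longrightarrow> b \<in> S \<longrightarrow> excess C S \<le> -3) \<and>
     (\<forall>S. a \<notin> S \<longrightarrow> b \<notin> S \<longrightarrow> \<not> linked C S a b \<longrightarrow> excess C S \<le> 0)"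

lemma splits_commute: "splits R a b \<Longrightarrow> splits R b a"
  unfolding splits_def using reachable_sym by metis

lemma full_commute: "full C a b n \<Longrightarrow> full C b a n"
  unfolding full_def by blast

lemma light_commute: "light C a b \<Longrightarrow> light C b a"
  unfolding light_def using reachable_sym by metis

text \<open>A single edge qualifies only through \<open>splits\<close>: its excess with both
  terminals removed is -4, below the -3 that each of two parallel constituents needs for their join
  to reach -2.\<close>

definition heavy_or_light :: "'v mgraph \<Rightarrow> 'v mgraph \<Rightarrow> 'v \<Rightarrow> 'v \<Rightarrow> bool" where
  "heavy_or_light C R a b \<longleftrightarrow> slack C a b \<and> slack C b a \<and>
     (full C a b (-2) \<and> tight R a b \<and> tight R b a \<or>
      light C a b \<and> (splits R a b \<or> tight R a b \<and> tight R b a \<and> full C a b (-3)))"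

text \<open>The witness of tightness in \<open>Y\<close> and any set with \<open>a\<close> but not
  \<open>b\<close> in \<open>X\<close> paste together to a set of the whole graph; the correction +1
  then leaves at most -1 for \<open>X\<close>.\<close>

lemma tight_slack:
  assumes XY: "attached X Y a b" and t: "tight Y a b"
  shows "slack X a b"
  unfolding slack_def
proof (intro allI impI)
  fix S assume S: "a \<in> S" "b \<notin> S"
  obtain T where T: "T \<subseteq> verts Y" "a \<in> T" "b \<notin> T" "excess Y T \<ge> 0"
    using t unfolding tight_def by blast
  let ?U = "(S \<inter> verts X) \<union> T"
  have "excess X ?U = excess X S"
    by (rule excess_cong[OF attachedD(1)[OF XY]]) (use S T attached_common[OF XY] in blast)
  moreover have "excess Y ?U = excess Y T"
    by (rule excess_cong[OF attachedD(2)[OF XY]]) (use S T attached_common[OF XY] in blast)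
  moreover have "excess (graph_join X Y) ?U = excess X ?U + excess Y ?U + 1"
    by (rule excess_attached(2)[OF XY]) (use S T in auto)
  moreover have "excess (graph_join X Y) ?U \<le> 0"
    using half_toughD[OF attachedD(7)[OF XY], where v = a and S = ?U] T(2) attachedD(8)[OF XY] by simp
  ultimately show "excess X S \<le> -1" using T(4) by linarith
qed

text \<open>The whole graph seen as a cycle of pieces: \<open>A\<close> from \<open>a\<close> to \<open>x\<close>, \<open>B\<close> from \<open>x\<close> to \<open>b\<close>, \<open>R\<close> from \<open>b\<close> to
  \<open>a\<close>.\<close>

definition ring :: "'v mgraph \<Rightarrow> 'v mgraph \<Rightarrow> 'v mgraph \<Rightarrow> 'v \<Rightarrow> 'v \<Rightarrow> 'v \<Rightarrow> bool" where
  "ring A B R a x b \<longleftrightarrow> multigraph A \<and> multigraph B \<and> multigraph R \<and>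
     verts A \<inter> verts B = {x} \<and> verts B \<inter> verts R = {b} \<and> verts A \<inter> verts R = {a} \<and>
     a \<noteq> x \<and> x \<noteq> b \<and> a \<noteq> b \<and>
     num_components A = 1 \<and> num_components B = 1 \<and> num_components R = 1 \<and>
     half_tough (graph_join A (graph_join B R))"

lemma ringD:
  assumes "ring A B R a x b"
  shows "multigraph A" "multigraph B" "multigraph R"
    "verts A \<inter> verts B = {x}" "verts B \<inter> verts R = {b}" "verts A \<inter> verts R = {a}"
    "a \<noteq> x" "x \<noteq> b" "a \<noteq> b"
    "half_tough (graph_join A (graph_join B R))"
    "a \<in> verts A" "x \<in> verts A" "x \<in> verts B" "b \<in> verts B" "b \<in> verts R" "a \<in> verts R"
    "b \<notin> verts A" "a \<notin> verts B" "x \<notin> verts R"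
  using assms unfolding ring_def by auto

lemma ring_common:
  assumes "ring A B R a x b"
  shows "v \<in> verts A \<Longrightarrow> v \<in> verts B \<Longrightarrow> v = x"
    "v \<in> verts B \<Longrightarrow> v \<in> verts R \<Longrightarrow> v = b"
    "v \<in> verts A \<Longrightarrow> v \<in> verts R \<Longrightarrow> v = a"
  using assms unfolding ring_def by blast+

lemma ring_mirror:
  assumes "ring A B R a x b"
  shows "ring B A R b x a"
proof -
  have "graph_join A (graph_join B R) = graph_join B (graph_join A R)"
    using graph_join_assoc[of A B R] graph_join_assoc[of B A R] graph_join_commute[of A B] by simp
  then show ?thesis using assms unfolding ring_def by (simp add: Int_commute) blast
qed

lemma ring_attached1:
  assumes r: "ring A B R a x b"
  shows "attached A (graph_join B R) a x"
proof -
  have "num_components (graph_join B R) = 1"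
    using r num_components_join_cut[of B R b] unfolding ring_def by blast
  moreover have "multigraph (graph_join B R)" using multigraph_join ringD[OF r] by blast
  moreover have "verts A \<inter> verts (graph_join B R) = {a, x}" using ringD(4,6)[OF r] by auto
  ultimately show ?thesis using r unfolding ring_def attached_def by blast
qed

lemma ring_attached2:
  assumes r: "ring A B R a x b"
  shows "attached B (graph_join A R) x b"
  using ring_attached1[OF ring_mirror[OF r]] by (rule attached_swap)

lemma ring_attached3:
  assumes r: "ring A B R a x b"
  shows "attached R (graph_join A B) a b"
proof -
  have "num_components (graph_join A B) = 1"
    using r num_components_join_cut[of A B x] unfolding ring_def by blast
  moreover have "multigraph (graph_join A B)" using multigraph_join ringD[OF r] by blast
  moreover have "verts R \<inter> verts (graph_join A B) = {a, b}" using ringD(5,6)[OF r] by auto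
  moreover have "graph_join A (graph_join B R) = graph_join R (graph_join A B)"
    using graph_join_assoc[of A B R] graph_join_commute[of "graph_join A B" R] by simp
  ultimately show ?thesis using r unfolding ring_def attached_def by simp
qed

section \<open>Types along a series join\<close>

text \<open>The witness \<open>S\<close> of tightness cannot contain \<open>b\<close>, since
  otherwise the full sets of \<open>A\<close> and \<open>B\<close> would complete it to a set of
  positive excess in the whole graph. With \<open>b\<close> outside, \<open>B\<close> contributes at
  most 1, which the gluing at \<open>b\<close> cancels, so \<open>R\<close> inherits the
  tightness.\<close>

lemma ring_heavy:
  assumes r: "ring A B R a x b"
    and full: "full A a x (-2)" "full B x b (-2)"
    and B: "slack B b x"
    and t: "tight (graph_join B R) a x"
  shows "tight R a b"
proof -
  obtain S where S: "S \<subseteq> verts (graph_join B R)" "a \<in> S" "x \<notin> S" "excess (graph_join B R) S \<ge> 0"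
    using t unfolding tight_def by blast
  obtain TA where TA: "TA \<subseteq> verts A" "a \<in> TA" "x \<in> TA" "excess A TA \<ge> -2"
    using full(1) unfolding full_def by blast
  obtain TB where TB: "TB \<subseteq> verts B" "x \<in> TB" "b \<in> TB" "excess B TB \<ge> -2"
    using full(2) unfolding full_def by blast
  note BR = ringD(2,3,5)[OF r]
  let ?T = "S \<inter> verts R"
  have RT: "excess R ?T = excess R S" by (rule excess_cong[OF ringD(3)[OF r]]) blast
  have "b \<notin> S"
  proof
    assume b: "b \<in> S"
    have "excess (graph_join B R) S = excess B S + excess R S + 2"
      by (rule excess_join_cut(1)[OF BR b])
    moreover have "excess B S \<le> -1" using B b S(3) unfolding slack_def by blast
    ultimately have RS: "excess R S \<ge> -1" using S(4) by linarith
    \<comment> \<open>All three gluing vertices are removed, so the total is at least -2 - 2 - 1 + 2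
      + 4 = 1.\<close>
    let ?U = "TA \<union> TB \<union> ?T"
    have "?U \<inter> verts A = TA \<inter> verts A" "?U \<inter> verts B = TB \<inter> verts B"
      "?U \<inter> verts R = S \<inter> verts R"
      using TA(1-3) TB(1-3) S(2) b ring_common[OF r] by blast+
    then have U: "excess A ?U = excess A TA" "excess B ?U = excess B TB" "excess R ?U = excess R S"
      using excess_cong ringD(1-3)[OF r] by blast+
    have "b \<in> ?U" "a \<in> ?U" "x \<in> ?U" using TA TB by auto
    then have "excess (graph_join A (graph_join B R)) ?U = excess A ?U + (excess B ?U + excess R ?U + 2) + 4"
      using excess_join_cut(1)[OF BR, of ?U] excess_attached(1)[OF ring_attached1[OF r], of ?U] by linarith
    moreover have "excess (graph_join A (graph_join B R)) ?U \<le> 0"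
      using half_toughD[OF ringD(10)[OF r], where v = a and S = ?U] TA(2) ringD(11)[OF r] by simp
    ultimately show False using U RS TA(4) TB(4) by linarith
  qed
  then have "excess (graph_join B R) S = excess B S + excess R S - 1"
    by (rule excess_join_cut(2)[OF BR])
  moreover have "excess B S \<le> 1" using excess_le_1[OF ring_attached2[OF r] S(3) \<open>b \<notin> S\<close>] .
  ultimately have "excess R S \<ge> 0" using S(4) by linarith
  then show ?thesis unfolding tight_def using S(2) \<open>b \<notin> S\<close> ringD(16)[OF r] RT
    by (intro exI[of _ ?T]) auto
qed

text \<open>This keeps the types apart: a heavy \<open>B\<close> would need
  \<open>graph_join A R\<close> tight at \<open>x\<close>, but a light \<open>A\<close> allows at
  most -3 + 0 + 2 if \<open>a\<close> is removed and -1 + 1 - 1 if not.\<close>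

lemma ring_light_tight:
  assumes r: "ring A B R a x b"
    and A: "slack A x a" "light A a x"
    and t: "tight (graph_join A R) x b"
  shows False
proof -
  obtain S where S: "x \<in> S" "b \<notin> S" "excess (graph_join A R) S \<ge> 0"
    using t unfolding tight_def by blast
  note AR = ringD(1,3,6)[OF r]
  show False
  proof (cases "a \<in> S")
    case True
    have "excess (graph_join A R) S = excess A S + excess R S + 2"
      by (rule excess_join_cut(1)[OF AR True])
    moreover have "excess A S \<le> -3" using A(2) True S(1) unfolding light_def by blast
    moreover have "excess R S \<le> 0" by (rule excess_le_0[OF ring_attached3[OF r] True S(2)])
    ultimately show False using S(3) by linarith
  next
    case False
    have "excess (graph_join A R) S = excess A S + excess R S - 1"
      by (rule excess_join_cut(2)[OF AR False])
    moreover have "excess A S \<le> -1" using A(1) False S(1) unfolding slack_def by blast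
    moreover have "excess R S \<le> 1" by (rule excess_le_1[OF ring_attached3[OF r] False S(2)])
    ultimately show False using S(3) by linarith
  qed
qed

text \<open>If \<open>b\<close> is removed, slackness of \<open>B\<close> leaves at least 0 for
  \<open>R\<close>, which is then tight at \<open>b\<close>. Otherwise both \<open>B\<close> and
  \<open>R\<close> must attain their bound 1; a light \<open>B\<close> then links \<open>x\<close>
  to \<open>b\<close>, so it is \<open>R\<close> that separates \<open>a\<close> from
  \<open>b\<close>.\<close>

lemma ring_splits:
  assumes r: "ring A B R a x b"
    and B: "slack B b x" "light B x b"
    and s: "splits (graph_join B R) a x"
  shows "splits R a b \<or> tight R b a"
proof -
  obtain S where S: "S \<subseteq> verts (graph_join B R)" "a \<notin> S" "x \<notin> S"
      "\<not> linked (graph_join B R) S a x" "excess (graph_join B R) S \<ge> 1"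
    using s unfolding splits_def by blast
  note BR = ringD(2,3,5)[OF r]
  let ?T = "S \<inter> verts R"
  have RT: "del_verts R ?T = del_verts R S" by (rule del_verts_cong[OF ringD(3)[OF r]]) blast
  have eT: "excess R ?T = excess R S" by (rule excess_cong[OF ringD(3)[OF r]]) blast
  show ?thesis
  proof (cases "b \<in> S")
    case True
    have "excess (graph_join B R) S = excess B S + excess R S + 2"
      by (rule excess_join_cut(1)[OF BR True])
    moreover have "excess B S \<le> -1" using B(1) True S(3) unfolding slack_def by blast
    ultimately have "excess R S \<ge> 0" using S(5) by linarith
    then have "tight R b a" unfolding tight_def using S(2) True ringD(15)[OF r] eT
      by (intro exI[of _ ?T]) auto
    then show ?thesis ..
  next
    case False
    have e: "excess (graph_join B R) S = excess B S + excess R S - 1"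
      by (rule excess_join_cut(2)[OF BR False])
    have R1: "excess R S \<le> 1" by (rule excess_le_1[OF ring_attached3[OF r] S(2) False])
    have B1: "excess B S \<le> 1" by (rule excess_le_1[OF ring_attached2[OF r] S(3) False])
    have "linked B S x b"
    proof (rule ccontr)
      assume "\<not> linked B S x b"
      then have "excess B S \<le> 0" using B(2) S(3) False unfolding light_def by blast
      then show False using e R1 S(5) by linarith
    qed
    then have "linked (graph_join B R) S b x"
      using reachable_join1 reachable_sym unfolding del_verts_join by metis
    then have "\<not> linked R S a b"
      using S(4) reachable_join2 reachable_trans unfolding del_verts_join by metis
    moreover have "excess R S \<ge> 1" using e B1 S(5) by linarith
    ultimately have "splits R a b" unfolding splits_def using S(2) False RT eT
      by (intro exI[of _ ?T]) auto
    then show ?thesis ..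
  qed
qed

lemma ring_slack:
  assumes r: "ring A B R a x b"
    and A: "slack A a x" "light A a x" and B: "slack B x b"
  shows "slack (graph_join A B) a b"
  unfolding slack_def
proof (intro allI impI)
  fix S assume S: "a \<in> S" "b \<notin> S"
  note AB = ringD(1,2,4)[OF r]
  show "excess (graph_join A B) S \<le> -1"
  proof (cases "x \<in> S")
    case True
    have "excess (graph_join A B) S = excess A S + excess B S + 2"
      by (rule excess_join_cut(1)[OF AB True])
    moreover have "excess A S \<le> -3" using A(2) True S(1) unfolding light_def by blast
    moreover have "excess B S \<le> -1" using B True S(2) unfolding slack_def by blast
    ultimately show ?thesis by linarith
  next
    case False
    have "excess (graph_join A B) S = excess A S + excess B S - 1"
      by (rule excess_join_cut(2)[OF AB False])
    moreover have "excess A S \<le> -1" using A(1) False S(1) unfolding slack_def by blast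
    moreover have "excess B S \<le> 1" by (rule excess_le_1[OF ring_attached2[OF r] False S(2)])
    ultimately show ?thesis by linarith
  qed
qed

text \<open>The thresholds reproduce themselves. With both terminals removed the bounds are -3 - 3 +
  2 and -1 - 1 - 1; for separating sets they are -1 - 1 + 2, or 0 + 1 - 1 because one constituent
  already separates.\<close>

lemma ring_light:
  assumes r: "ring A B R a x b"
    and A: "slack A a x" "slack A x a" "light A a x"
    and B: "slack B x b" "slack B b x" "light B x b"
  shows "light (graph_join A B) a b"
proof -
  note AB = ringD(1,2,4)[OF r]
  have "excess (graph_join A B) S \<le> -3" if S: "a \<in> S" "b \<in> S" for S
  proof (cases "x \<in> S")
    case True
    have "excess (graph_join A B) S = excess A S + excess B S + 2"
      by (rule excess_join_cut(1)[OF AB True])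
    moreover have "excess A S \<le> -3" using A(3) True S(1) unfolding light_def by blast
    moreover have "excess B S \<le> -3" using B(3) True S(2) unfolding light_def by blast
    ultimately show ?thesis by linarith
  next
    case False
    have "excess (graph_join A B) S = excess A S + excess B S - 1"
      by (rule excess_join_cut(2)[OF AB False])
    moreover have "excess A S \<le> -1" using A(1) False S(1) unfolding slack_def by blast
    moreover have "excess B S \<le> -1" using B(2) False S(2) unfolding slack_def by blast
    ultimately show ?thesis by linarith
  qed
  moreover have "excess (graph_join A B) S \<le> 0"
    if S: "a \<notin> S" "b \<notin> S" "\<not> linked (graph_join A B) S a b" for S
  proof (cases "x \<in> S")
    case True
    have "excess (graph_join A B) S = excess A S + excess B S + 2"
      by (rule excess_join_cut(1)[OF AB True])
    moreover have "excess A S \<le> -1" using A(2) True S(1) unfolding slack_def by blast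
    moreover have "excess B S \<le> -1" using B(1) True S(2) unfolding slack_def by blast
    ultimately show ?thesis by linarith
  next
    case False
    have "excess (graph_join A B) S = excess A S + excess B S - 1"
      by (rule excess_join_cut(2)[OF AB False])
    moreover have "excess A S \<le> 1" by (rule excess_le_1[OF ring_attached1[OF r] S(1) False])
    moreover have "excess B S \<le> 1" by (rule excess_le_1[OF ring_attached2[OF r] False S(2)])
    moreover have "\<not> linked A S a x \<or> \<not> linked B S x b"
      using S(3) reachable_join1 reachable_join2 reachable_trans unfolding del_verts_join by metis
    then have "excess A S \<le> 0 \<or> excess B S \<le> 0"
      using A(3) B(3) S(1,2) False unfolding light_def by blast
    ultimately show ?thesis by linarith
  qed
  ultimately show ?thesis unfolding light_def by blast
qed

lemma num_components_le_card:
  assumes X: "multigraph X"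
  shows "num_components X \<le> card (verts X)"
proof -
  obtain f where f: "component_labelling X f"
    by (rule labelling_exists[OF X, of "{}"]) auto
  have "finite (verts X)" using X by (simp add: multigraph_def)
  then show ?thesis using num_components_labelling[OF f] card_image_le by metis
qed

text \<open>The second condition discards the empty set while the graph stays connected, where
  excess 1 means nothing. If \<open>e\<close> is a bridge, the empty set is a genuine
  witness.\<close>

definition critical_edge :: "'v mgraph \<Rightarrow> 'v set \<Rightarrow> bool" where
  "critical_edge H e \<longleftrightarrow>
     (\<exists>S. excess (del_edge H e) S \<ge> 1 \<and> num_components (del_verts (del_edge H e) S) > 1)"

text \<open>Deleting the edge leaves exactly \<open>R\<close>, so criticality yields a set of excess
  at least 1 in \<open>R\<close>. It must avoid both ends and separate them, since anything else
  contradicts half-toughness of the whole.\<close>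

lemma heavy_or_light_edge:
  assumes E: "E = \<lparr>verts = {a, b}, edges = {#{a, b}#}\<rparr>"
    and att: "attached E R a b"
    and crit: "critical_edge (graph_join E R) {a, b}"
  shows "heavy_or_light E R a b"
proof -
  have le: "excess E S \<le> int (card ({a, b} - S)) - 2 * int (card (S \<inter> {a, b}))" for S
    using num_components_le_card[OF multigraph_del_verts[OF attachedD(1)[OF att]], of S]
    by (simp add: excess_def E)
  have both: "excess E S = -4" if "a \<in> S" "b \<in> S" for S
  proof -
    have sets: "{a, b} - S = {}" "S \<inter> {a, b} = {a, b}" using that by auto
    have "excess E S \<le> -4" using le[of S] attachedD(4)[OF att] unfolding sets by simp
    moreover have "excess E S \<ge> -4" using attachedD(4)[OF att] sets(2) by (simp add: excess_def E)
    ultimately show ?thesis by linarith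
  qed
  have one: "excess E S \<le> -1" if "a \<in> S \<and> b \<notin> S \<or> a \<notin> S \<and> b \<in> S" for S
  proof -
    have "{a, b} - S = {b} \<and> S \<inter> {a, b} = {a} \<or> {a, b} - S = {a} \<and> S \<inter> {a, b} = {b}"
      using that by auto
    then show ?thesis using le[of S] by (elim disjE conjE) simp_all
  qed
  have linked: "linked E S a b" if "a \<notin> S" "b \<notin> S" for S
    using that by (intro reachable_edge multigraph_del_verts attachedD(1)[OF att]) (simp add: E)
  have "slack E a b" "slack E b a" unfolding slack_def using one by blast+
  moreover have "light E a b" unfolding light_def using both linked by auto
  moreover have "splits R a b"
  proof -
    have "del_edge (graph_join E R) {a, b} = R"
      using attachedD(10,11)[OF att] by (intro mgraph.equality) (auto simp: del_edge_def E)
    then obtain S where S: "excess R S \<ge> 1" "num_components (del_verts R S) > 1"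
      using crit unfolding critical_edge_def by auto
    have "S \<inter> verts R \<noteq> {}"
    proof
      assume "S \<inter> verts R = {}"
      then have "del_verts R S = del_verts R {}"
        by (intro del_verts_cong attachedD(2)[OF att]) simp
      then show False using S(2) attachedD(6)[OF att] by simp
    qed
    then obtain v where v: "v \<in> S" "v \<in> verts R" by blast
    have J: "excess (graph_join E R) S \<le> 0"
      using half_toughD[OF attachedD(7)[OF att] v(1)] v(2) by simp
    have ab: "a \<notin> S" "b \<notin> S"
    proof -
      have "\<not> (a \<in> S \<and> b \<in> S)" using both excess_attached(1)[OF att, of S] J S(1) by auto
      moreover have "\<not> (a \<in> S \<and> b \<notin> S)"
        using excess_le_0[OF attached_commute[OF att], of S] S(1) by auto
      moreover have "\<not> (b \<in> S \<and> a \<notin> S)"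
        using excess_le_0[OF attached_swap[OF attached_commute[OF att]], of S] S(1) by auto
      ultimately show "a \<notin> S" "b \<notin> S" by blast+
    qed
    have "S \<inter> verts E = {}" using ab by (simp add: E)
    then have E1: "excess E S = 1"
      using excess_disjoint[OF attachedD(1)[OF att]] attachedD(5)[OF att] by simp
    have "\<not> linked R S a b"
    proof
      assume "linked R S a b"
      from excess_attached(4)[OF att ab linked[OF ab] this] show False using E1 J S(1) by linarith
    qed
    moreover have "del_verts R (S \<inter> verts R) = del_verts R S"
      by (rule del_verts_cong[OF attachedD(2)[OF att]]) blast
    moreover have "excess R (S \<inter> verts R) = excess R S"
      by (rule excess_cong[OF attachedD(2)[OF att]]) blast
    ultimately show ?thesis unfolding splits_def using ab S(1)
      by (intro exI[of _ "S \<inter> verts R"]) simp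
  qed
  ultimately show ?thesis unfolding heavy_or_light_def by blast
qed

lemma ring_heavy_or_light:
  assumes r: "ring A B R a x b"
    and A: "heavy_or_light A (graph_join B R) a x" and B: "heavy_or_light B (graph_join A R) x b"
  shows "heavy_or_light (graph_join A B) R a b"
proof -
  note m = ring_mirror[OF r]
  note att = attached_commute[OF ring_attached3[OF r]]
  have sA: "slack A a x" "slack A x a" using A unfolding heavy_or_light_def by blast+
  have sB: "slack B x b" "slack B b x" using B unfolding heavy_or_light_def by blast+
  have lA: "\<not> tight (graph_join A R) x b" if "light A a x"
    using ring_light_tight[OF r sA(2) that] by blast
  have lB: "\<not> tight (graph_join B R) x a" if "light B x b"
    using ring_light_tight[OF m sB(1) light_commute[OF that]] by blast
  \<comment> \<open>A light constituent denies the other one the tightness required by every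
    alternative except light with \<open>splits\<close>; hence the types agree.\<close>
  consider (heavy) "full A a x (-2)" "tight (graph_join B R) a x" "full B x b (-2)" "tight (graph_join A R) b x"
    | (light) "light A a x" "splits (graph_join B R) a x" "light B x b" "splits (graph_join A R) x b"
    using A B lA lB unfolding heavy_or_light_def by blast
  then show ?thesis
  proof cases
    case heavy
    have t: "tight R a b" "tight R b a"
      using ring_heavy[OF r heavy(1,3) sB(2) heavy(2)]
        ring_heavy[OF m full_commute[OF heavy(3)] full_commute[OF heavy(1)] sA(1) heavy(4)] .
    have s: "slack (graph_join A B) a b" "slack (graph_join A B) b a"
      using tight_slack[OF att t(1)] tight_slack[OF attached_swap[OF att] t(2)] .
    obtain TA where TA: "TA \<subseteq> verts A" "a \<in> TA" "x \<in> TA" "excess A TA \<ge> -2"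
      using heavy(1) unfolding full_def by blast
    obtain TB where TB: "TB \<subseteq> verts B" "x \<in> TB" "b \<in> TB" "excess B TB \<ge> -2"
      using heavy(3) unfolding full_def by blast
    have "(TA \<union> TB) \<inter> verts A = TA \<inter> verts A" "(TA \<union> TB) \<inter> verts B = TB \<inter> verts B"
      using TA(1-3) TB(1-3) ring_common[OF r] by blast+
    then have "excess A (TA \<union> TB) = excess A TA" "excess B (TA \<union> TB) = excess B TB"
      using excess_cong ringD(1,2)[OF r] by blast+
    moreover have "excess (graph_join A B) (TA \<union> TB) = excess A (TA \<union> TB) + excess B (TA \<union> TB) + 2"
      by (rule excess_join_cut(1)[OF ringD(1,2,4)[OF r]]) (use TA in blast)
    ultimately have "excess (graph_join A B) (TA \<union> TB) \<ge> -2" using TA(4) TB(4) by linarith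
    then have "full (graph_join A B) a b (-2)" unfolding full_def using TA(1,2) TB(1,3)
      by (intro exI[of _ "TA \<union> TB"]) auto
    then show ?thesis unfolding heavy_or_light_def using s t by blast
  next
    case light
    have s: "slack (graph_join A B) a b" using ring_slack[OF r sA(1) light(1) sB(1)] .
    have s': "slack (graph_join A B) b a"
      using ring_slack[OF m sB(2) light_commute[OF light(3)] sA(2)] graph_join_commute[of A B] by simp
    have l: "light (graph_join A B) a b" using ring_light[OF r sA light(1) sB light(3)] .
    have "splits R a b \<or> tight R b a" using ring_splits[OF r sB(2) light(3,2)] .
    moreover have "splits R b a \<or> tight R a b"
      using ring_splits[OF m sA(1) light_commute[OF light(1)] splits_commute[OF light(4)]] .
    \<comment> \<open>The vertex \<open>x\<close> survives the removal of both terminals, whence at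
      least 1 - 4.\<close>
    moreover have "full (graph_join A B) a b (-3)"
    proof -
      have "x \<in> verts (del_verts (graph_join A B) {a, b})" using ringD[OF r] by auto
      then have "num_components (del_verts (graph_join A B) {a, b}) > 0"
        by (rule num_components_pos[rotated]) (intro multigraph_del_verts attachedD(1)[OF att])
      moreover have "{a, b} \<inter> verts (graph_join A B) = {a, b}" using ringD[OF r] by auto
      ultimately have "excess (graph_join A B) {a, b} \<ge> -3"
        using ringD(9)[OF r] by (simp add: excess_def)
      then show ?thesis unfolding full_def using ringD(11,14)[OF r]
        by (intro exI[of _ "{a, b}"]) simp
    qed
    ultimately show ?thesis unfolding heavy_or_light_def using s s' l splits_commute[of R b a] by blast
  qed
qed

section \<open>Types in a parallel join\<close>

lemma attached_bundle:
  assumes att: "attached (graph_join A B) R a b"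
    and AB: "multigraph A" "multigraph B" "verts A \<inter> verts B = {a, b}"
      "num_components A = 1" "num_components B = 1"
  shows "attached A (graph_join B R) a b" "verts B \<inter> verts R = {a, b}"
proof -
  have c: "v = a \<or> v = b" if "v \<in> verts A \<union> verts B" "v \<in> verts R" for v
    using attached_common[OF att] that by simp
  have ab: "a \<in> verts R" "b \<in> verts R" using attachedD(10,11)[OF att] .
  have abAB: "a \<in> verts A" "b \<in> verts A" "a \<in> verts B" "b \<in> verts B" using AB(3) by auto
  show BR: "verts B \<inter> verts R = {a, b}" using c ab abAB by blast
  have "verts A \<inter> verts R \<subseteq> {a, b}" using c by blast
  then have "verts A \<inter> verts (graph_join B R) = {a, b}"
    using AB(3) by (auto simp: Int_Un_distrib)
  moreover have "num_components (graph_join B R) = 1"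
    using num_components_join_pair[OF AB(2) attachedD(2)[OF att] BR attachedD(4)[OF att] AB(5)]
      attachedD(6)[OF att] by blast
  moreover have "multigraph (graph_join B R)"
    using multigraph_join[OF AB(2) attachedD(2)[OF att]] .
  moreover have "half_tough (graph_join A (graph_join B R))"
    using attachedD(7)[OF att] unfolding graph_join_assoc .
  ultimately show "attached A (graph_join B R) a b"
    using AB(1,4) attachedD(4)[OF att] unfolding attached_def by blast
qed

text \<open>Such a set leaves \<open>a\<close> and \<open>b\<close> unlinked in \<open>B\<close>, so
  gluing \<open>B\<close> and \<open>R\<close> costs 2, while each offers at most 1. Hence no
  constituent of a parallel join can rely on \<open>splits\<close>.\<close>

lemma bundle_not_splits:
  assumes A: "attached A (graph_join B R) a b" and B: "attached B X a b" and R: "attached R Y a b"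
    and BR: "verts B \<inter> verts R = {a, b}"
  shows "\<not> splits (graph_join B R) a b"
proof
  assume "splits (graph_join B R) a b"
  then obtain S where S: "a \<notin> S" "b \<notin> S" "\<not> linked (graph_join B R) S a b" "excess (graph_join B R) S \<ge> 1"
    unfolding splits_def by blast
  have "\<not> linked B S a b" using S(3) reachable_join1 unfolding del_verts_join by blast
  then have "excess (graph_join B R) S = excess B S + excess R S - 2"
    using excess_join_pair(3)[OF attachedD(1)[OF B] attachedD(1)[OF R] BR attachedD(4)[OF B] S(1,2)] by blast
  moreover have "excess B S \<le> 1" "excess R S \<le> 1"
    using excess_le_1[OF B S(1,2)] excess_le_1[OF R S(1,2)] .
  ultimately show False using S(4) by linarith
qed

text \<open>Slackness of \<open>B\<close> cancels the correction +1, so the tightness must come from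
  \<open>R\<close>.\<close>

lemma bundle_tight:
  assumes B: "multigraph B" "slack B a b" and R: "multigraph R" "a \<in> verts R"
    and BR: "verts B \<inter> verts R = {a, b}" "a \<noteq> b"
    and t: "tight (graph_join B R) a b"
  shows "tight R a b"
proof -
  obtain S where S: "a \<in> S" "b \<notin> S" "excess (graph_join B R) S \<ge> 0"
    using t unfolding tight_def by blast
  have "excess (graph_join B R) S = excess B S + excess R S + 1"
    by (rule excess_join_pair(2)[OF B(1) R(1) BR S(1,2)])
  moreover have "excess B S \<le> -1" using B(2) S unfolding slack_def by blast
  moreover have "excess R (S \<inter> verts R) = excess R S" by (rule excess_cong[OF R(1)]) blast
  ultimately show ?thesis unfolding tight_def using S R(2)
    by (intro exI[of _ "S \<inter> verts R"]) simp
qed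

lemma full_mono: "full C a b m \<Longrightarrow> n \<le> m \<Longrightarrow> full C a b n"
  unfolding full_def by (meson order_trans)

text \<open>With \<open>splits\<close> excluded, both constituents have sets of excess at least -3
  through both terminals, and the union of these reaches -3 - 3 + 4 = -2: the join is heavy.\<close>

lemma bundle_heavy_or_light:
  assumes att: "attached (graph_join A B) R a b"
    and A: "multigraph A" "num_components A = 1" and B: "multigraph B" "num_components B = 1"
    and AB: "verts A \<inter> verts B = {a, b}"
    and oA: "heavy_or_light A (graph_join B R) a b" and oB: "heavy_or_light B (graph_join A R) a b"
  shows "heavy_or_light (graph_join A B) R a b"
proof -
  have attA: "attached A (graph_join B R) a b" and BR: "verts B \<inter> verts R = {a, b}"
    using attached_bundle[OF att A(1) B(1) AB A(2) B(2)] .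
  have att': "attached (graph_join B A) R a b" using att graph_join_commute[of A B] by simp
  have BA: "verts B \<inter> verts A = {a, b}" using AB by (simp add: Int_commute)
  have attB: "attached B (graph_join A R) a b" and AR: "verts A \<inter> verts R = {a, b}"
    using attached_bundle[OF att' B(1) A(1) BA B(2) A(2)] .
  note attR = attached_commute[OF att]
  note ns = bundle_not_splits[OF attA attB attR BR] bundle_not_splits[OF attB attA attR AR]
  have tA: "tight (graph_join B R) a b" "tight (graph_join B R) b a" and fA: "full A a b (-3)"
    using oA ns(1) full_mono[of A a b "-2" "-3"] unfolding heavy_or_light_def by auto
  have fB: "full B a b (-3)"
    using oB ns(2) full_mono[of B a b "-2" "-3"] unfolding heavy_or_light_def by auto
  have sB: "slack B a b" "slack B b a" using oB unfolding heavy_or_light_def by blast+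
  have BR': "verts B \<inter> verts R = {b, a}" using BR by (simp add: insert_commute)
  have t: "tight R a b" "tight R b a"
    using bundle_tight[OF B(1) sB(1) attachedD(2,10)[OF att] BR attachedD(4)[OF att] tA(1)]
      bundle_tight[OF B(1) sB(2) attachedD(2,11)[OF att] BR' attachedD(4)[OF att, symmetric] tA(2)] .
  have s: "slack (graph_join A B) a b" "slack (graph_join A B) b a"
    using tight_slack[OF att t(1)] tight_slack[OF attached_swap[OF att] t(2)] .
  obtain TA where TA: "TA \<subseteq> verts A" "a \<in> TA" "b \<in> TA" "excess A TA \<ge> -3"
    using fA unfolding full_def by blast
  obtain TB where TB: "TB \<subseteq> verts B" "a \<in> TB" "b \<in> TB" "excess B TB \<ge> -3"
    using fB unfolding full_def by blast
  have c: "v = a \<or> v = b" if "v \<in> verts A" "v \<in> verts B" for v using AB that by blast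
  have "(TA \<union> TB) \<inter> verts A = TA \<inter> verts A" "(TA \<union> TB) \<inter> verts B = TB \<inter> verts B"
    using TA(1-3) TB(1-3) c by blast+
  then have "excess A (TA \<union> TB) = excess A TA" "excess B (TA \<union> TB) = excess B TB"
    using excess_cong A(1) B(1) by blast+
  moreover have "excess (graph_join A B) (TA \<union> TB) = excess A (TA \<union> TB) + excess B (TA \<union> TB) + 4"
    by (rule excess_join_pair(1)[OF A(1) B(1) AB attachedD(4)[OF att]]) (use TA in blast)+
  ultimately have "excess (graph_join A B) (TA \<union> TB) \<ge> -2" using TA(4) TB(4) by linarith
  then have "full (graph_join A B) a b (-2)" unfolding full_def using TA(1-3) TB(1)
    by (intro exI[of _ "TA \<union> TB"]) auto
  then show ?thesis unfolding heavy_or_light_def using s t by blast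
qed

text \<open>The complement varies because the sibling of a constituent moves into it; the whole
  graph, and with it the critical edges, stays the same.\<close>

lemma binary_sp_heavy_or_light:
  assumes "binary_sp C a b" "attached C R a b" "\<And>e. e \<in># edges C \<Longrightarrow> critical_edge (graph_join C R) e"
  shows "heavy_or_light C R a b"
  using assms
proof (induction arbitrary: R rule: binary_sp.induct)
  case (edge s t)
  show ?case by (rule heavy_or_light_edge[OF refl edge(2)]) (rule edge(3), simp)
next
  case (series A s x B t)
  note bA = binary_sp_basic[OF series.hyps(1)] and bB = binary_sp_basic[OF series.hyps(2)]
  have x: "v = x" if "v \<in> verts A" "v \<in> verts B" for v using series.hyps(3) that by blast
  have c: "v = s \<or> v = t" if "v \<in> verts A \<union> verts B" "v \<in> verts R" for v
    using attached_common[OF series.prems(1)] that by simp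
  have n: "s \<notin> verts B" "t \<notin> verts A" using x bA bB by blast+
  note att = attachedD[OF series.prems(1)]
  have "verts A \<inter> verts R = {s}" "verts B \<inter> verts R = {t}" using c n bA bB att(10,11) by blast+
  moreover have "half_tough (graph_join A (graph_join B R))" using att(7) unfolding graph_join_assoc .
  ultimately have r: "ring A B R s x t"
    using series.hyps(3) bA bB att(2,4,6) unfolding ring_def by blast
  have g: "graph_join (graph_join A B) R = graph_join A (graph_join B R)"
    "graph_join (graph_join A B) R = graph_join B (graph_join A R)"
    using graph_join_assoc[of A B R] graph_join_assoc[of B A R] graph_join_commute[of A B] by simp_all
  have "heavy_or_light A (graph_join B R) s x"
    by (rule series.IH(1)[OF ring_attached1[OF r]]) (use series.prems(2) g(1) in simp)
  moreover have "heavy_or_light B (graph_join A R) x t"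
    by (rule series.IH(2)[OF ring_attached2[OF r]]) (use series.prems(2) g(2) in simp)
  ultimately show ?case by (rule ring_heavy_or_light[OF r])
next
  case (parallel A s t B)
  note bA = binary_sp_basic[OF parallel.hyps(1)] and bB = binary_sp_basic[OF parallel.hyps(2)]
  have mA: "multigraph A" "num_components A = 1" and mB: "multigraph B" "num_components B = 1"
    using bA bB by blast+
  have BA: "verts B \<inter> verts A = {s, t}" using parallel.hyps(3) by (simp add: Int_commute)
  have g: "graph_join (graph_join A B) R = graph_join A (graph_join B R)"
    "graph_join (graph_join A B) R = graph_join B (graph_join A R)"
    using graph_join_assoc[of A B R] graph_join_assoc[of B A R] graph_join_commute[of A B] by simp_all
  have att': "attached (graph_join B A) R s t"
    using parallel.prems(1) graph_join_commute[of A B] by simp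
  have "heavy_or_light A (graph_join B R) s t"
    by (rule parallel.IH(1)[OF attached_bundle(1)[OF parallel.prems(1) mA(1) mB(1) parallel.hyps(3) mA(2) mB(2)]])
      (use parallel.prems(2) g(1) in simp)
  moreover have "heavy_or_light B (graph_join A R) s t"
    by (rule parallel.IH(2)[OF attached_bundle(1)[OF att' mB(1) mA(1) BA mB(2) mA(2)]])
      (use parallel.prems(2) g(2) in simp)
  ultimately show ?case by (rule bundle_heavy_or_light[OF parallel.prems(1) mA mB parallel.hyps(3)])
qed

subsection \<open>Toughness one half\<close>

text \<open>The analogue of \<open>excess_le_1\<close> for one gluing vertex: \<open>Q\<close> stays
  whole, and its excess 1 is cancelled by the correction -1. The value 1 arises only for sets that
  miss \<open>K\<close>.\<close>

lemma hung_excess_le_1: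
  assumes m: "multigraph Q" "multigraph K" and QK: "verts Q \<inter> verts K = {b}"
    and n: "num_components Q = 1" "num_components K = 1"
    and J: "half_tough (graph_join Q K)" and b: "b \<notin> S"
  shows "excess K S \<le> 1"
proof (cases "S \<inter> verts K = {}")
  case True
  then show ?thesis using excess_disjoint[OF m(2)] n(2) by simp
next
  case False
  let ?T = "S \<inter> verts K"
  obtain v where v: "v \<in> ?T" using False by blast
  have "excess (graph_join Q K) ?T \<le> 0" using half_toughD[OF J v] v by simp
  moreover have "excess (graph_join Q K) ?T = excess Q ?T + excess K ?T - 1"
    by (rule excess_join_cut(2)[OF m QK]) (use b in blast)
  moreover have "v = b" if "v \<in> verts Q" "v \<in> verts K" for v using QK that by blast
  then have "?T \<inter> verts Q = {}" using b by blast
  then have "excess Q ?T = 1" using excess_disjoint[OF m(1)] n(1) by simp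
  moreover have "excess K ?T = excess K S" by (rule excess_cong[OF m(2)]) blast
  ultimately show ?thesis by linarith
qed

text \<open>With \<open>K\<close> attached at \<open>b\<close> only, neither tightness at \<open>a\<close> nor splitting can come from \<open>K\<close>. So \<open>B \<union> K\<close>
  is not tight at \<open>a\<close>, which makes \<open>A\<close> (and \<open>B\<close>) light, but then nothing splits.\<close>

lemma hung_bundle_False:
  assumes A: "binary_sp A a b" and B: "binary_sp B a b" and AB: "verts A \<inter> verts B = {a, b}"
    and K: "multigraph K" "num_components K = 1" "(verts A \<union> verts B) \<inter> verts K = {b}"
    and J: "half_tough (graph_join (graph_join A B) K)"
    and crit: "\<And>e. e \<in># edges (graph_join A B) \<Longrightarrow> critical_edge (graph_join (graph_join A B) K) e"
  shows False
proof -
  have mA: "multigraph A" "num_components A = 1" "a \<in> verts A" "b \<in> verts A" "a \<noteq> b"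
    and mB: "multigraph B" "num_components B = 1" "a \<in> verts B" "b \<in> verts B"
    using binary_sp_basic[OF A] binary_sp_basic[OF B] by blast+
  have c: "v = b" if "v \<in> verts A \<union> verts B" "v \<in> verts K" for v using K(3) that by blast
  have bK: "b \<in> verts K" using K(3) by blast
  have AK: "verts A \<inter> verts K = {b}" and BK: "verts B \<inter> verts K = {b}"
    using c bK mA(4) mB(4) by blast+
  have BA: "verts B \<inter> verts A = {a, b}" using AB by (simp add: Int_commute)
  have g: "graph_join (graph_join A B) K = graph_join A (graph_join B K)"
    "graph_join (graph_join A B) K = graph_join B (graph_join A K)"
    using graph_join_assoc[of A B K] graph_join_assoc[of B A K] graph_join_commute[of A B] by simp_all
  have "verts A \<inter> verts (graph_join B K) = {a, b}" "verts B \<inter> verts (graph_join A K) = {a, b}"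
    using AB BA AK BK by (simp_all add: Int_Un_distrib insert_commute)
  then have attA: "attached A (graph_join B K) a b" and attB: "attached B (graph_join A K) a b"
    using mA mB J[unfolded g(1)] J[unfolded g(2)]
      multigraph_join[OF mA(1) K(1)] multigraph_join[OF mB(1) K(1)]
      num_components_join_cut[OF mA(1) K(1) AK mA(2) K(2)] num_components_join_cut[OF mB(1) K(1) BK mB(2) K(2)]
    unfolding attached_def by simp_all
  have oA: "heavy_or_light A (graph_join B K) a b"
    by (rule binary_sp_heavy_or_light[OF A attA]) (use crit g(1) in simp)
  have oB: "heavy_or_light B (graph_join A K) a b"
    by (rule binary_sp_heavy_or_light[OF B attB]) (use crit g(2) in simp)
  have K1: "excess K S \<le> 1" if "b \<notin> S" for S
    by (rule hung_excess_le_1[OF multigraph_join[OF mA(1) mB(1)] K(1) _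
          num_components_join_pair[OF mA(1) mB(1) AB mA(5) mA(2) mB(2)] K(2) J that])
      (use K(3) in simp)
  \<comment> \<open>The excess of such a set is at most -1 + 1 - 1.\<close>
  have nt: "\<not> tight (graph_join X K) a b"
    if X: "multigraph X" "verts X \<inter> verts K = {b}" "slack X a b" for X
  proof
    assume "tight (graph_join X K) a b"
    then obtain S where S: "a \<in> S" "b \<notin> S" "excess (graph_join X K) S \<ge> 0"
      unfolding tight_def by blast
    have "excess (graph_join X K) S = excess X S + excess K S - 1"
      by (rule excess_join_cut(2)[OF X(1) K(1) X(2) S(2)])
    moreover have "excess X S \<le> -1" using X(3) S unfolding slack_def by blast
    ultimately show False using K1[OF S(2)] S(3) by linarith
  qed
  \<comment> \<open>Lightness comes from the type of \<open>A\<close>, the splitting set from the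
    type of \<open>B\<close>; together they allow at most 0 + 1 - 1, short of the required
    1.\<close>
  have lA: "light A a b" "splits (graph_join A K) a b"
    using oA oB nt[OF mA(1) AK] nt[OF mB(1) BK] unfolding heavy_or_light_def by blast+
  then obtain S where S: "a \<notin> S" "b \<notin> S" "\<not> linked (graph_join A K) S a b" "excess (graph_join A K) S \<ge> 1"
    unfolding splits_def by blast
  have "excess (graph_join A K) S = excess A S + excess K S - 1"
    by (rule excess_join_cut(2)[OF mA(1) K(1) AK S(2)])
  moreover have "\<not> linked A S a b" using S(3) reachable_join1 unfolding del_verts_join by blast
  then have "excess A S \<le> 0" using lA(1) S unfolding light_def by blast
  ultimately show False using K1[OF S(2)] S(4) by linarith
qed

lemma vertex_degree_join: "vertex_degree (graph_join X Y) v = vertex_degree X v + vertex_degree Y v"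
  by (simp add: vertex_degree_def)

lemma vertex_degree_0:
  assumes "multigraph X" "v \<notin> verts X"
  shows "vertex_degree X v = 0"
proof -
  have "{#e \<in># edges X. v \<in> e#} = {#}"
    using assms by (auto simp: multigraph_def filter_mset_eq_conv)
  then show ?thesis by (simp add: vertex_degree_def)
qed

text \<open>In a series join the constituent next to \<open>K\<close> is absorbed into
  \<open>K\<close>, and the other one again hangs at a single vertex. As parallel joins are
  impossible, this descent ends in a single edge at \<open>a\<close>.\<close>

lemma hung_leaf:
  assumes "binary_sp Q a b" "multigraph K" "num_components K = 1" "verts Q \<inter> verts K = {b}"
    "half_tough (graph_join Q K)"
    "\<And>e. e \<in># edges Q \<Longrightarrow> critical_edge (graph_join Q K) e"
  shows "vertex_degree (graph_join Q K) a = 1"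
  using assms
proof (induction arbitrary: K rule: binary_sp.induct)
  case (edge s t)
  then have "s \<notin> verts K" by auto
  then have "vertex_degree K s = 0" by (rule vertex_degree_0[OF edge(2)])
  then show ?case unfolding vertex_degree_join by (simp add: vertex_degree_def)
next
  case (series A s x B t)
  note bA = binary_sp_basic[OF series.hyps(1)] and bB = binary_sp_basic[OF series.hyps(2)]
  have x: "v = x" if "v \<in> verts A" "v \<in> verts B" for v using series.hyps(3) that by blast
  have c: "v = t" if "v \<in> verts A \<union> verts B" "v \<in> verts K" for v
    using series.prems(3) that by auto
  have tK: "t \<in> verts K" using series.prems(3) by auto
  have BK: "verts B \<inter> verts K = {t}" using c tK bB by blast
  have "t \<notin> verts A" using x bB by blast
  then have AK: "verts A \<inter> verts (graph_join B K) = {x}"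
    using c series.hyps(3) by auto
  have "multigraph (graph_join B K)" using multigraph_join bB series.prems(1) by blast
  moreover have "num_components (graph_join B K) = 1"
    using num_components_join_cut[OF _ series.prems(1) BK _ series.prems(2)] bB by blast
  ultimately show ?case
    using series.IH(1)[of "graph_join B K"] AK series.prems(4,5) by (simp add: graph_join_assoc)
next
  case (parallel A s t B)
  have "(verts A \<union> verts B) \<inter> verts K = {t}" using parallel.prems(3) by simp
  then show ?case
    using hung_bundle_False[OF parallel.hyps parallel.prems(1,2) _ parallel.prems(4,5)] by blast
qed

lemma half_tough_if_tough:
  assumes G: "multigraph G" and t: "tough (1 / 2) G"
  shows "half_tough G"
  unfolding half_tough_def
proof (intro allI impI)
  fix S assume S: "S \<inter> verts G \<noteq> {}"
  let ?T = "S \<inter> verts G"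
  have "finite ?T" using G by (simp add: multigraph_def)
  then have pos: "card ?T \<ge> 1" using S by (simp add: Suc_le_eq card_gt_0_iff)
  have "num_components (del_verts G ?T) \<le> 2 * card ?T"
  proof (cases "num_components (del_verts G ?T) > 1")
    case True
    then have "cutset G ?T" by (simp add: cutset_def)
    then have "real (card ?T) \<ge> 1 / 2 * real (num_components (del_verts G ?T))"
      using t unfolding tough_def by blast
    then show ?thesis by linarith
  qed (use pos in linarith)
  then have "excess G ?T \<le> 0" by (simp add: excess_def)
  moreover have "excess G ?T = excess G S" by (rule excess_cong[OF G]) blast
  ultimately show "excess G S \<le> 0" by simp
qed

lemma critical_edge_if_not_tough:
  assumes "\<not> tough (1 / 2) (del_edge G e)"
  shows "critical_edge G e"
proof -
  obtain S where S: "cutset (del_edge G e) S"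
      "real (card S) < 1 / 2 * real (num_components (del_verts (del_edge G e) S))"
    using assms unfolding tough_def by (auto simp: not_le)
  have "S \<inter> verts (del_edge G e) = S" using S(1) unfolding cutset_def by blast
  moreover have "2 * card S < num_components (del_verts (del_edge G e) S)" using S(2) by linarith
  ultimately have "excess (del_edge G e) S \<ge> 1" by (simp add: excess_def)
  then show ?thesis using S(1) unfolding critical_edge_def cutset_def by blast
qed

lemma minimally_toughD:
  assumes "minimally_tough t G"
  shows "tough t G" "\<And>e. e \<in># edges G \<Longrightarrow> \<not> tough t (del_edge G e)" "\<And>r. r > t \<Longrightarrow> \<not> tough r G"
  using assms unfolding minimally_tough_def tough_iff_le_toughness by auto

lemma minimally_half_tough_leaf:
  assumes sp: "binary_sp G a b" and min: "minimally_tough (1 / 2) G"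
  shows "vertex_degree G a = 1"
proof -
  \<comment> \<open>Gluing a single vertex at \<open>b\<close> changes nothing, but puts all of
    \<open>G\<close> into the hanging position.\<close>
  let ?K = "\<lparr>verts = {b}, edges = {#}\<rparr>"
  note G = binary_sp_basic[OF sp]
  have join: "graph_join G ?K = G" by (intro mgraph.equality) (use G in auto)
  have K: "multigraph ?K" by (simp add: multigraph_def)
  moreover have "num_components ?K = 1"
    using num_components_pos[OF K, of b] num_components_le_card[OF K] by simp
  moreover have "verts G \<inter> verts ?K = {b}" using G by simp
  moreover have "half_tough (graph_join G ?K)"
    unfolding join using half_tough_if_tough minimally_toughD(1)[OF min] G by blast
  moreover have "critical_edge (graph_join G ?K) e" if "e \<in># edges G" for e
    unfolding join by (rule critical_edge_if_not_tough[OF minimally_toughD(2)[OF min that]])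
  ultimately show ?thesis using hung_leaf[OF sp, of ?K] unfolding join by blast
qed

subsection \<open>Toughness above one half\<close>

lemma reachable_cong:
  assumes "verts X = verts Y" "set_mset (edges X) = set_mset (edges Y)"
  shows "reachable X = reachable Y"
  using assms by (simp add: reachable_def)

text \<open>Reachability sees only which edges occur, not how often.\<close>

lemma tough_del_parallel_edge:
  assumes "count (edges G) e \<ge> 2"
  shows "tough t (del_edge G e) \<longleftrightarrow> tough t G"
proof -
  have "replicate_mset 2 e \<subseteq># edges G"
    using assms by (simp add: count_le_replicate_mset_subset_eq[symmetric])
  then obtain M where M: "edges G = replicate_mset 2 e + M"
    unfolding mset_subset_eq_exists_conv by blast
  have "set_mset (edges G - {#e#}) = set_mset (edges G)"
    unfolding M by (simp add: numeral_2_eq_2)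
  then have "reachable (del_verts (del_edge G e) S) = reachable (del_verts G S)" for S
    by (intro reachable_cong) (simp_all only: del_edge_def del_verts_simps mgraph.simps set_mset_filter)
  then have "num_components (del_verts (del_edge G e) S) = num_components (del_verts G S)" for S
    by (simp add: num_components_def del_edge_def)
  moreover have "verts (del_edge G e) = verts G" by (simp add: del_edge_def)
  ultimately show ?thesis unfolding tough_def cutset_def by simp
qed

text \<open>Inner vertices of a constituent keep their degree in a join. This leaves the join of two
  single edges: in series the middle vertex has degree 2, in parallel the edge would be
  double.\<close>

lemma binary_sp_degree_2:
  assumes "binary_sp G s t" "\<And>e. count (edges G) e \<le> 1"
  shows "verts G = {s, t} \<and> edges G = {#{s, t}#} \<or> (\<exists>v \<in> verts G - {s, t}. vertex_degree G v = 2)"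
  using assms
proof (induction rule: binary_sp.induct)
  case (edge s t)
  then show ?case by simp
next
  case (series A s x B t)
  note bA = binary_sp_basic[OF series.hyps(1)] and bB = binary_sp_basic[OF series.hyps(2)]
  have x: "v = x" if "v \<in> verts A" "v \<in> verts B" for v using series.hyps(3) that by blast
  have cA: "count (edges A) e \<le> 1" and cB: "count (edges B) e \<le> 1" for e
    using series.prems[of e] by simp_all
  consider (A) v where "v \<in> verts A - {s, x}" "vertex_degree A v = 2"
    | (B) v where "v \<in> verts B - {x, t}" "vertex_degree B v = 2"
    | (edges) "edges A = {#{s, x}#}" "edges B = {#{x, t}#}"
    using series.IH(1)[OF cA] series.IH(2)[OF cB] by blast
  then show ?case
  proof cases
    case A
    then have "v \<notin> verts B" using x by blast
    then have "vertex_degree (graph_join A B) v = 2"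
      using A(2) vertex_degree_0[of B v] bB by (simp add: vertex_degree_join)
    moreover have "v \<in> verts (graph_join A B) - {s, t}"
      using A(1) \<open>v \<notin> verts B\<close> bB by auto
    ultimately show ?thesis by blast
  next
    case B
    then have "v \<notin> verts A" using x by blast
    then have "vertex_degree (graph_join A B) v = 2"
      using B(2) vertex_degree_0[of A v] bA by (simp add: vertex_degree_join)
    moreover have "v \<in> verts (graph_join A B) - {s, t}"
      using B(1) \<open>v \<notin> verts A\<close> bA by auto
    ultimately show ?thesis by blast
  next
    case edges
    then have "vertex_degree (graph_join A B) x = 2"
      by (simp add: vertex_degree_join) (simp add: vertex_degree_def)
    moreover have "x \<in> verts (graph_join A B) - {s, t}" using bA bB by auto
    ultimately show ?thesis by blast
  qed
next
  case (parallel A s t B)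
  note bA = binary_sp_basic[OF parallel.hyps(1)] and bB = binary_sp_basic[OF parallel.hyps(2)]
  have x: "v \<in> {s, t}" if "v \<in> verts A" "v \<in> verts B" for v using parallel.hyps(3) that by blast
  have cA: "count (edges A) e \<le> 1" and cB: "count (edges B) e \<le> 1" for e
    using parallel.prems[of e] by simp_all
  consider (A) v where "v \<in> verts A - {s, t}" "vertex_degree A v = 2"
    | (B) v where "v \<in> verts B - {s, t}" "vertex_degree B v = 2"
    | (edges) "edges A = {#{s, t}#}" "edges B = {#{s, t}#}"
    using parallel.IH(1)[OF cA] parallel.IH(2)[OF cB] by blast
  then show ?case
  proof cases
    case A
    then have "v \<notin> verts B" using x by blast
    then have "vertex_degree (graph_join A B) v = 2"
      using A(2) vertex_degree_0[of B v] bB by (simp add: vertex_degree_join)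
    then show ?thesis using A(1) by auto
  next
    case B
    then have "v \<notin> verts A" using x by blast
    then have "vertex_degree (graph_join A B) v = 2"
      using B(2) vertex_degree_0[of A v] bA by (simp add: vertex_degree_join)
    then show ?thesis using B(1) by auto
  next
    case edges
    then show ?thesis using parallel.prems[of "{s, t}"] by simp
  qed
qed

lemma card_neighbours_le:
  assumes G: "multigraph G"
  shows "card (\<Union>e \<in> {e \<in> set_mset (edges G). v \<in> e}. e - {v}) \<le> vertex_degree G v"
proof -
  let ?F = "{#e \<in># edges G. v \<in> e#}"
  have "card (\<Union>e \<in> set_mset ?F. e - {v}) \<le> (\<Sum>e \<in> set_mset ?F. card (e - {v}))"
    by (rule card_UN_le) simp
  also have "\<dots> \<le> (\<Sum>e \<in> set_mset ?F. count ?F e)"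
  proof (rule sum_mono)
    fix e assume e: "e \<in> set_mset ?F"
    then have "card e = 2" "v \<in> e" using G by (auto simp: multigraph_def)
    then have "card (e - {v}) = 1" by simp
    moreover have "count ?F e > 0" using e by (simp only: count_greater_zero_iff)
    ultimately show "card (e - {v}) \<le> count ?F e" by linarith
  qed
  also have "\<dots> = size ?F" by (simp only: size_multiset_overloaded_eq)
  finally show ?thesis by (simp add: vertex_degree_def)
qed

lemma num_components_ge_2:
  assumes X: "multigraph X" and uv: "u \<in> verts X" "v \<in> verts X" "(u, v) \<notin> reachable X"
  shows "num_components X \<ge> 2"
proof -
  obtain f where f: "component_labelling X f"
    by (rule labelling_exists[OF X, of "{}"]) auto
  have "f u \<noteq> f v" using labelling_reachable_iff[OF f uv(1,2)] uv(3) by blast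
  moreover have "finite (f ` verts X)" using X by (simp add: multigraph_def)
  moreover have "{f u, f v} \<subseteq> f ` verts X" using uv by blast
  ultimately have "card (f ` verts X) \<ge> 2" by (metis card_2_iff card_mono)
  then show ?thesis using num_components_labelling[OF f] by simp
qed

lemma isolated_not_reachable:
  assumes "\<And>e. e \<in># edges X \<Longrightarrow> v \<notin> e" "(v, u) \<in> reachable X"
  shows "u = v"
proof -
  have "(v, u) \<in> {(u, v). {u, v} \<in># edges X}\<^sup>*" using assms(2) by (simp add: reachable_def)
  then show ?thesis by induction (use assms(1) in auto)
qed

text \<open>The neighbours of \<open>v\<close>, at most two, isolate it and form a cutset if any
  further vertex exists. Otherwise there are at most three vertices, and the given cutset
  \<open>S\<close> has at most one element because two components survive.\<close>

lemma tough_le_1: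
  assumes G: "multigraph G" and v: "v \<in> verts G" "vertex_degree G v = 2"
    and t: "tough t G" and cut: "cutset G S"
  shows "t \<le> 1"
proof (cases "t \<le> 0")
  case False
  define N where "N = (\<Union>e \<in> {e \<in> set_mset (edges G). v \<in> e}. e - {v})"
  have fin: "finite (verts G)" using G by (simp add: multigraph_def)
  have N: "card N \<le> 2" "N \<subseteq> verts G" "v \<notin> N"
    using card_neighbours_le[OF G, of v] v(2) G by (auto simp: N_def multigraph_def)
  show ?thesis
  proof (cases "verts G \<subseteq> insert v N")
    case True
    have "finite N" using N(2) fin finite_subset by blast
    then have "card (verts G) \<le> card (insert v N)" using card_mono[OF _ True] by simp
    also have "\<dots> \<le> 3" using N(1,3) \<open>finite N\<close> by simp
    finally have V: "card (verts G) \<le> 3" .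
    have S: "S \<subseteq> verts G" "num_components (del_verts G S) \<ge> 2" using cut unfolding cutset_def by auto
    have "num_components (del_verts G S) \<le> card (verts G - S)"
      using num_components_le_card[OF multigraph_del_verts[OF G], of S] by simp
    also have "\<dots> = card (verts G) - card S" using S(1) fin card_Diff_subset finite_subset by metis
    finally have "card S \<le> 1" using S(2) V by linarith
    have "t * 2 \<le> t * real (num_components (del_verts G S))"
      using False S(2) by (intro mult_left_mono) auto
    also have "\<dots> \<le> real (card S)" using t cut unfolding tough_def by blast
    finally show ?thesis using \<open>card S \<le> 1\<close> by linarith
  next
    case False2: False
    then obtain u where u: "u \<in> verts G" "u \<noteq> v" "u \<notin> N" by blast
    have "v \<notin> e" if e: "e \<in># edges (del_verts G N)" for e
    proof
      assume "v \<in> e"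
      have "e \<in># edges G" "e \<inter> N = {}" using e by auto
      then have "card e = 2" using G by (simp add: multigraph_def)
      then have "e \<noteq> {v}" by auto
      then obtain w where "w \<in> e" "w \<noteq> v" using \<open>v \<in> e\<close> by blast
      then have "w \<in> N" unfolding N_def using \<open>e \<in># edges G\<close> \<open>v \<in> e\<close> by blast
      then show False using \<open>e \<inter> N = {}\<close> \<open>w \<in> e\<close> by blast
    qed
    then have "(v, u) \<notin> reachable (del_verts G N)" using isolated_not_reachable u(2) by metis
    then have c: "num_components (del_verts G N) \<ge> 2"
      using num_components_ge_2[OF multigraph_del_verts[OF G], of v N u] v(1) N(3) u by simp
    then have "cutset G N" using N(2) unfolding cutset_def by simp
    then have "t * real (num_components (del_verts G N)) \<le> real (card N)"
      using t unfolding tough_def by blast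
    moreover have "t * 2 \<le> t * real (num_components (del_verts G N))"
      using False c by (intro mult_left_mono) auto
    ultimately show ?thesis using N(1) by linarith
  qed
qed simp

lemma no_cutset_if_card_le_2:
  assumes G: "multigraph G" "num_components G = 1" "card (verts G) \<le> 2" and cut: "cutset G S"
  shows False
proof -
  have fin: "finite (verts G)" using G(1) by (simp add: multigraph_def)
  have S: "S \<subseteq> verts G" "num_components (del_verts G S) > 1" using cut unfolding cutset_def by auto
  have "S \<noteq> {}" using S(2) G(2) by auto
  then have "verts G - S \<subset> verts G" using S(1) by blast
  then have "card (verts G - S) < card (verts G)" by (rule psubset_card_mono[OF fin])
  moreover have "num_components (del_verts G S) \<le> card (verts G - S)"
    using num_components_le_card[OF multigraph_del_verts[OF G(1)], of S] by simp
  ultimately show False using S(2) G(3) by linarith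
qed

theorem theorem4p14:
  fixes G :: "'v mgraph" and t :: real
  assumes "t \<ge> 1 / 2"
    and "series_parallel G"
    and "minimally_tough t G"
  shows "\<exists>v \<in> verts G. int (vertex_degree G v) = \<lceil>2 * t\<rceil>"
proof -
  obtain a b where "sp_terminals G a b" using assms(2) unfolding series_parallel_def by blast
  then have sp: "binary_sp G a b" by (rule sp_terminals_binary)
  note G = binary_sp_basic[OF sp]
  note min = minimally_toughD[OF assms(3)]
  show ?thesis
  proof (cases "t = 1 / 2")
    case True
    have "vertex_degree G a = 1" by (rule minimally_half_tough_leaf[OF sp assms(3)[unfolded True]])
    moreover have "\<lceil>2 * t\<rceil> = 1" unfolding True by simp
    moreover have "a \<in> verts G" using G by simp
    ultimately show ?thesis by (intro bexI[of _ a]) simp_all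
  next
    case False
    \<comment> \<open>Finite toughness provides a cutset: without one, every real number would
      qualify.\<close>
    have "\<not> tough (t + 1) G" by (rule min(3)) simp
    then obtain S where cut: "cutset G S" unfolding tough_def by blast
    have simple: "count (edges G) e \<le> 1" for e
    proof (rule ccontr)
      assume "\<not> count (edges G) e \<le> 1"
      then have c: "count (edges G) e \<ge> 2" by linarith
      then have "e \<in># edges G" by (intro count_inI) linarith
      then show False using min(1) min(2)[of e] tough_del_parallel_edge[OF c, of t] by blast
    qed
    have "verts G \<noteq> {a, b}"
    proof
      assume "verts G = {a, b}"
      then have "card (verts G) \<le> 2" by (simp add: card_insert_if)
      then show False using no_cutset_if_card_le_2[OF _ _ _ cut] G by blast
    qed
    then obtain v where v: "v \<in> verts G" "vertex_degree G v = 2"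
      using binary_sp_degree_2[OF sp simple] by auto
    have "multigraph G" using G by simp
    then have "t \<le> 1" using v min(1) cut by (rule tough_le_1)
    moreover have "t > 1 / 2" using assms(1) False by linarith
    ultimately have "\<lceil>2 * t\<rceil> = 2" by (intro ceiling_unique) simp_all
    then show ?thesis using v by (intro bexI[of _ v]) simp_all
  qed
qed

end
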